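(* Let $n,r$ be positive integers with $n\geq 5$, and consider the equation $$|T_{-n}T_{-n-1}T_{-n-2}\cdots T_{-n-r}|=m_1!\,m_2!\cdots m_k!$$ where $k\ge1$ and $m_1\leq m_2\leq\cdots\leq m_k$ are positive integers. The only products $|T_{-n}T_{-n-1}\cdots T_{-n-r}|$ (that is, the only pairs $(n,r)$) for which this equation has a solution $(k,m_1,\ldots,m_k)$ are the following, for which the displayed equalities hold: \begin{align*} &|T_{-5}T_{-6}|=|T_{-5}T_{-6}T_{-7}|=3!,\\ &|T_{-5}\cdots T_{-8}|=4!,\\ &|T_{-5}\cdots T_{-9}|=(2!)^3\cdot 4!,\\ &|T_{-5}\cdots T_{-10}|=(2!)^3\cdot 5!,\\ &|T_{-5}\cdots T_{-13}|=(2!)^2\cdot 5!\cdot 7!,\\ &|T_{-5}\cdots T_{-14}|=3!\cdot 6!\cdot 7!,\\ &|T_{-6}T_{-7}T_{-8}|=2!\cdot 3!,\\ &|T_{-6}\cdots T_{-9}|=(2!)^2\cdot 4!,\\ &|T_{-6}\cdots T_{-10}|=(2!)^2\cdot 5!,\\ &|T_{-6}\cdots T_{-13}|=2!\cdot 5!\cdot 7!,\\ &|T_{-7}T_{-8}|=(2!)^2,\\ &|T_{-7}T_{-8}T_{-9}|=|T_{-8}T_{-9}|=(2!)^5,\\ &|T_{-7}\cdots T_{-14}|=|T_{-8}\cdots T_{-14}|=6!\cdot 7!. \end{align*} Equivalently, $(n,r)$ belongs to $\{(5,1),(5,2),(5,3),(5,4),(5,5),(5,8),(5,9),(6,2),(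6,3),(6,4),(6,7),(7,1),(7,2),(8,1),(7,7),(8,6)\}$.
   Context: The Tribonacci numbers with negative indices are defined by $T_{0}=0$, $T_{-1}=0$, $T_{-2}=1$ and $T_{-n}=-T_{-(n-1)}-T_{-(n-2)}+T_{-(n-3)}$ for $n\ge 3$. Here $T_{-a}\cdots T_{-b}$ with $a<b$ denotes the product of $T_{-j}$ over all integers $a\le j\le b$. *)

theory Defs
  imports Complex_Main
begin

text \<open>The argument is the negated index: \<open>trib_neg n\<close> stands for $T_{-n}$.\<close>

fun trib_neg :: "nat \<Rightarrow> int" where
  "trib_neg 0 = 0"
| "trib_neg (Suc 0) = 0"
| "trib_neg (Suc (Suc 0)) = 1"
| "trib_neg (Suc (Suc (Suc n))) =
     - trib_neg (Suc (Suc n)) - trib_neg (Suc n) + trib_neg n"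

text \<open>\<open>trib_neg_prod a b\<close> stands for $T_{-a} \cdots T_{-b}$; the second argument is the
  last index, not the number of factors.\<close>

definition trib_neg_prod :: "nat \<Rightarrow> nat \<Rightarrow> int" where
  "trib_neg_prod a b = (\<Prod>j=a..b. trib_neg j)"

end

theory Submission
  imports Defs "HOL-Computational_Algebra.Primes" "HOL-Library.Multiset"
begin

text \<open>
  For a window of indices $n, \ldots, n + r$ write $P = T_{-n} \cdots T_{-n-r}$, and let $V$ be the
  exponent of 2 in $P$. The theorem holds because
  $|P|$ grows much faster than its power of 2, whereas a product of factorials is bounded in terms of
  its power of 2. Three estimates make this precise. They avoid lower bounds for an individual
  $|T_{-j}|$, which are delicate because the dominant characteristic roots are a complex conjugate
  pair.

  The exponent of 2 is small. The fourth power of the shift acts on the sequence as $1 + 2 \Delta$, with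
  $\Delta$ the forward difference, so that the Newton expansion of $h \mapsto T_{-(a+4h)}$ converges
  2-adically very fast, and its first terms decide the valuation. Expanding at the zeros
  $T_0 = T_{-1} = T_{-17} = 0$ shows that, to the right of them, $T_{-4h}$ has the same valuation as $2h(h-1)$
  and $T_{-(4h+1)}$ the same as $2h(h-4)$ (\<open>multiplicity_2_trib_neg_4h\<close>,
  \<open>multiplicity_2_trib_neg_4h_plus_1\<close>); all other terms are odd. With Legendre's formula this gives
  $V \le 3p + 2 + 4k$, where $p$ is the number of disjoint pairs of neighbours in the window and
  $2^k$ is about $n/4$ (\<open>sum_multiplicity_2_trib_neg_le\<close>).

  The product is large. The oscillating part of the sequence has a norm form that is multiplied by
  $\tau = 1.839\ldots$ in each step, so two neighbouring terms cannot both be small. If both are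
  nonzero integers, their product is at least the larger one, and multiplying over disjoint pairs
  bounds $|P|$ from below by an exponential in $p(n+p)$ (\<open>trib_neg_prod_growth\<close>).

  A product of factorials with exponent $V \ge 22$ is at most $(2V+4)^V$, and at most $47^V$ if all
  factorials are of numbers below 103 (\<open>fact_prod_le_power\<close>, \<open>fact_prod_le_47_power\<close>).

  The prime 103 separates two regimes, because it divides $T_{-j}$ whenever $17$ divides $j$. If 103
  does not divide $P$, then $|P| \le 47^V$, which contradicts the growth for $n \ge 425$; for smaller
  $n$ the window lies between two multiples of 17, and since the bound $47^V$ is multiplicative, it is
  enough to compare $|T_{-j}|$ with its own power of 2 one index at a time, except for small indices,
  where all windows are inspected. If 103 divides $P$, then some factorial is at least $103!$, so
  $V \ge 96$, and the window must be long or $n$ very large; the two bounds on $|P|$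
  then exclude each other, where the prime 499, a divisor of $T_{-55}$ and $T_{-57}$, takes care of
  the windows that start early.
\<close>

section \<open>Valuations at 2 of the Tribonacci numbers\<close>

definition fdiff :: "(nat \<Rightarrow> int) \<Rightarrow> nat \<Rightarrow> int" where
  "fdiff f n = f (n + 1) - f n"

lemma trib_neg_rec: "trib_neg (n + 3) = - trib_neg (n + 2) - trib_neg (n + 1) + trib_neg n"
  by (simp add: eval_nat_numeral)

lemma trib_neg_shift_4: "trib_neg (n + 4) = trib_neg n + 2 * fdiff trib_neg n"
  by (simp add: fdiff_def eval_nat_numeral)

text \<open>The shift by 4 is $1 + 2 \Delta$, hence the shift by $4h$ is $(1 + 2\Delta)^h$; expanding the power gives
  the formula. The characteristic polynomial of the sequence enters through
  $x^4 \equiv 2x - 1$ modulo $x^3 + x^2 + x - 1$.\<close>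

lemma newton_step_4:
  assumes "\<And>n. f (n + 4) = f n + 2 * fdiff f n"
  shows "f (n + 4 * h) = (\<Sum>i\<le>h. 2 ^ i * int (h choose i) * (fdiff ^^ i) f n)"
  using assms
proof (induction h arbitrary: f)
  case 0
  then show ?case by simp
next
  case (Suc h)
  have d: "fdiff f (m + 4) = fdiff f m + 2 * fdiff (fdiff f) m" for m
    using Suc.prems[of m] Suc.prems[of "m + 1"]
    by (simp add: fdiff_def algebra_simps)
  define a where "a i = (fdiff ^^ i) f n" for i
  have "f (n + 4 * Suc h) = f (n + 4 * h) + 2 * fdiff f (n + 4 * h)"
    using Suc.prems[of "n + 4 * h"] by (simp add: algebra_simps)
  also have "f (n + 4 * h) = (\<Sum>i\<le>h. 2 ^ i * int (h choose i) * a i)"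
    unfolding a_def using Suc.IH[OF Suc.prems] .
  also have "\<dots> = a 0 + (\<Sum>i\<le>h. 2 ^ Suc i * int (h choose Suc i) * a (Suc i))"
  proof -
    have "(\<Sum>i\<le>h. 2 ^ i * int (h choose i) * a i) = (\<Sum>i\<le>Suc h. 2 ^ i * int (h choose i) * a i)"
      by simp
    then show ?thesis by (subst (asm) sum.atMost_Suc_shift) simp
  qed
  also have "fdiff f (n + 4 * h) = (\<Sum>i\<le>h. 2 ^ i * int (h choose i) * a (Suc i))"
    unfolding a_def using Suc.IH[of "fdiff f", OF d] by (simp add: funpow_swap1)
  finally have "f (n + 4 * Suc h) =
      a 0 + (\<Sum>i\<le>h. 2 ^ Suc i * int (Suc h choose Suc i) * a (Suc i))"
    by (simp add: sum_distrib_left sum.distrib algebra_simps)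
  then show ?case unfolding a_def[symmetric] by (subst sum.atMost_Suc_shift) simp
qed

text \<open>Only the power of 2 in a factor matters for divisibility by a power of 2; this lets the
  denominators $i$ and $i(i-1)$ of binomial coefficients be replaced by their 2-parts.\<close>

lemma power_dvd_if_dvd_mult:
  fixes i :: nat and c :: int
  assumes "2 ^ e dvd int i * c" "0 < i"
  shows "2 ^ e dvd 2 ^ multiplicity 2 i * c"
proof -
  obtain q where q: "i = 2 ^ multiplicity 2 i * q" "\<not> 2 dvd q"
    using multiplicity_decompose'[of i 2] assms(2) by auto
  have "coprime (2 ^ e) (int q)" using q(2) by (simp add: coprime_left_2_iff_odd)
  moreover have "2 ^ e dvd int q * (2 ^ multiplicity 2 i * c)"
    using assms(1) by (subst (asm) q(1)) (simp add: algebra_simps)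
  ultimately show ?thesis using coprime_dvd_mult_right_iff by blast
qed

lemma multiplicity_2_less:
  fixes i :: nat
  assumes "0 < i"
  shows "multiplicity 2 i < i"
proof -
  from assms have "2 ^ multiplicity 2 i \<le> i" by (intro dvd_imp_le multiplicity_dvd)
  then show ?thesis using less_exp[of "multiplicity 2 i"] by linarith
qed

lemma multiplicity_2_less_exponent:
  fixes i :: nat
  assumes "i < 2 ^ e" "0 < i"
  shows "multiplicity 2 i < e"
proof -
  have "2 ^ multiplicity 2 i \<le> i" using assms by (intro dvd_imp_le multiplicity_dvd)
  then have "(2::nat) ^ multiplicity 2 i < 2 ^ e" using assms by linarith
  then show ?thesis using power_less_imp_less_exp by (metis one_less_numeral_iff semiring_norm(76))
qed

text \<open>The denominator $i$ leaves at least four of the $i$ factors 2 in $2^i$. This fails for $i = 3$ and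
  $i = 4$, which is why these two Newton terms need separate treatment below.\<close>

lemma multiplicity_2_add_4_le:
  assumes "5 \<le> i" shows "multiplicity 2 i + 4 \<le> (i::nat)"
proof -
  have pow: "m + 6 < 2 ^ (m + 3)" for m :: nat by (induction m) (simp_all add: power_add)
  have *: "(n::nat) < 2 ^ (n - 3)" if "6 \<le> n" for n
  proof -
    define m where "m = n - 6"
    then have "n = m + 6" "n - 3 = m + 3" using that by simp_all
    then show ?thesis using pow[of m] by metis
  qed
  show ?thesis
  proof (cases "i = 5")
    case True
    have "\<not> 2 dvd (5::nat)" by simp
    then show ?thesis using True by (simp add: not_dvd_imp_multiplicity_0)
  next
    case False
    then have "multiplicity 2 i < i - 3"
      using assms by (intro multiplicity_2_less_exponent *) auto
    then show ?thesis by simp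
  qed
qed

lemma multiplicity_2_pred_mult_le:
  assumes "3 \<le> i" shows "multiplicity 2 (i * (i - 1)) + 2 \<le> (i::nat)"
proof -
  have pow: "m + 3 < 2 ^ (m + 2)" for m :: nat by (induction m) (simp_all add: power_add)
  have *: "(n::nat) < 2 ^ (n - 1)" if "3 \<le> n" for n
  proof -
    define m where "m = n - 3"
    then have "n = m + 3" "n - 1 = m + 2" using that by simp_all
    then show ?thesis using pow[of m] by metis
  qed
  have m: "multiplicity 2 (i * (i - 1)) = multiplicity 2 i + multiplicity 2 (i - 1)"
    using assms by (intro prime_elem_multiplicity_mult_distrib) auto
  have a: "multiplicity 2 i < i - 1" using assms by (intro multiplicity_2_less_exponent *) auto
  have b: "multiplicity 2 (i - 1) < i - 1" using assms by (intro multiplicity_2_less) auto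
  show ?thesis
  proof (cases "even i")
    case True
    then have "\<not> 2 dvd (i - 1)" using assms by (simp add: even_diff_nat)
    then show ?thesis using m a by (simp add: not_dvd_imp_multiplicity_0)
  next
    case False
    then show ?thesis using m b by (simp add: not_dvd_imp_multiplicity_0)
  qed
qed

text \<open>By the absorption identity $i \binom{h}{i} = h \binom{h-1}{i-1}$.\<close>

lemma power_multiplicity_dvd_mult_binomial:
  assumes "0 < i"
  shows "2 ^ multiplicity 2 h dvd int i * int (h choose i)"
proof (cases "h = 0")
  case True
  then have z: "h choose i = 0" using assms by (intro binomial_eq_0) auto
  show ?thesis unfolding z by simp
next
  case False
  have "i * (h choose i) = h * (h - 1 choose (i - 1))"
    using assms False Suc_times_binomial_eq[of "h - 1" "i - 1"] by (simp add: mult.commute)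
  then have "int i * int (h choose i) = int h * int (h - 1 choose (i - 1))"
    by (metis of_nat_mult)
  moreover have "2 ^ multiplicity 2 h dvd int h"
    by (metis multiplicity_dvd of_nat_dvd_iff of_nat_numeral of_nat_power)
  ultimately show ?thesis by simp
qed

lemma binomial_2_adic:
  fixes h i :: nat
  assumes "5 \<le> i"
  shows "2 ^ (multiplicity 2 h + 4) dvd 2 ^ i * int (h choose i)"
proof -
  have "2 ^ multiplicity 2 h dvd 2 ^ multiplicity 2 i * int (h choose i)"
    using assms by (intro power_dvd_if_dvd_mult power_multiplicity_dvd_mult_binomial) auto
  then have "2 ^ multiplicity 2 h * 2 ^ 4 dvd 2 ^ 4 * (2 ^ multiplicity 2 i * int (h choose i))"
    by (simp add: mult.commute)
  then have "2 ^ (multiplicity 2 h + 4) dvd 2 ^ (multiplicity 2 i + 4) * int (h choose i)"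
    by (simp add: power_add algebra_simps)
  also have "\<dots> dvd 2 ^ i * int (h choose i)"
    using multiplicity_2_add_4_le[OF assms] by (intro mult_dvd_mono le_imp_power_dvd dvd_refl)
  finally show ?thesis .
qed

text \<open>The expansion at index 0 starts with the term of index 2, because $T_0 = T_{-1} = 0$; from there on
  two factors can be absorbed at once: $i(i-1)\binom{h}{i} = h(h-1)\binom{h-2}{i-2}$.\<close>

lemma binomial_2_adic_pred:
  fixes h i :: nat
  assumes "3 \<le> i"
  shows "2 ^ (multiplicity 2 (h * (h - 1)) + 2) dvd 2 ^ i * int (h choose i)"
proof (cases "h \<le> 1")
  case True
  then have z: "h choose i = 0" using assms by (intro binomial_eq_0) auto
  show ?thesis unfolding z by simp
next
  case False
  define j where "j = i - 2"
  define g where "g = h - 2"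
  have ij: "i = Suc (Suc j)" "i - 1 = Suc j" "i - 2 = j"
    and hg: "h = Suc (Suc g)" "h - 1 = Suc g" "h - 2 = g"
    using assms False unfolding j_def g_def by simp_all
  have "Suc j * (i * (h choose i)) = Suc j * (h * (Suc g choose Suc j))"
    unfolding ij hg using Suc_times_binomial_eq[of "Suc g" "Suc j"] by (simp only: mult.commute)
  also have "\<dots> = h * (Suc j * (Suc g choose Suc j))" by (rule mult.left_commute)
  also have "Suc j * (Suc g choose Suc j) = Suc g * (g choose j)"
    using Suc_times_binomial_eq[of g j] by (simp only: mult.commute)
  finally have "(i * (i - 1)) * (h choose i) = (h * (h - 1)) * (h - 2 choose (i - 2))"
    unfolding ij(2,3) hg(2,3) by (simp only: mult_ac)
  then have "int (i * (i - 1)) * int (h choose i) = int (h * (h - 1)) * int (h - 2 choose (i - 2))"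
    by (metis of_nat_mult)
  moreover have "2 ^ multiplicity 2 (h * (h - 1)) dvd int (h * (h - 1))"
    by (metis multiplicity_dvd of_nat_dvd_iff of_nat_numeral of_nat_power)
  ultimately have "2 ^ multiplicity 2 (h * (h - 1)) dvd int (i * (i - 1)) * int (h choose i)"
    by (metis dvd_mult2)
  then have "2 ^ multiplicity 2 (h * (h - 1)) dvd 2 ^ multiplicity 2 (i * (i - 1)) * int (h choose i)"
    by (rule power_dvd_if_dvd_mult) (use assms in auto)
  then have "2 ^ multiplicity 2 (h * (h - 1)) * 2 ^ 2 dvd 2 ^ 2 * (2 ^ multiplicity 2 (i * (i - 1)) * int (h choose i))"
    by (simp add: mult.commute)
  then have "2 ^ (multiplicity 2 (h * (h - 1)) + 2) dvd 2 ^ (multiplicity 2 (i * (i - 1)) + 2) * int (h choose i)"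
    by (simp add: power_add algebra_simps)
  also have "\<dots> dvd 2 ^ i * int (h choose i)"
    using multiplicity_2_pred_mult_le[OF assms] by (intro mult_dvd_mono le_imp_power_dvd dvd_refl)
  finally show ?thesis .
qed

lemma newton_step_4_cong:
  assumes "\<And>n. f (n + 4) = f n + 2 * fdiff f n"
    and "\<And>i. c \<le> i \<Longrightarrow> m dvd 2 ^ i * int (h choose i)"
  shows "m dvd f (n + 4 * h) - (\<Sum>i<c. 2 ^ i * int (h choose i) * (fdiff ^^ i) f n)"
proof -
  let ?g = "\<lambda>i. 2 ^ i * int (h choose i) * (fdiff ^^ i) f n"
  have "f (n + 4 * h) = (\<Sum>i\<le>h. ?g i)" by (rule newton_step_4[OF assms(1)])
  also have "\<dots> = (\<Sum>i\<in>{..<c + h + 1}. ?g i)"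
    by (rule sum.mono_neutral_left) (auto simp: binomial_eq_0)
  also have "\<dots> = (\<Sum>i<c. ?g i) + (\<Sum>i\<in>{c..<c + h + 1}. ?g i)"
    by (simp add: lessThan_atLeast0 sum.atLeastLessThan_concat)
  finally have "f (n + 4 * h) - (\<Sum>i<c. ?g i) = (\<Sum>i\<in>{c..<c + h + 1}. ?g i)" by simp
  moreover have "m dvd (\<Sum>i\<in>{c..<c + h + 1}. ?g i)"
    using assms(2) by (intro dvd_sum dvd_mult2[of m "2 ^ i * int (h choose i)" for i]) auto
  ultimately show ?thesis by simp
qed

text \<open>A list of consecutive terms is produced in linear time from three of them; unfolding the
  recursion of the sequence itself would take exponential time.\<close>

fun trib_list :: "nat \<Rightarrow> int \<Rightarrow> int \<Rightarrow> int \<Rightarrow> int list" where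
  "trib_list 0 a b c = []"
| "trib_list (Suc k) a b c = a # trib_list k b c (a - b - c)"

lemma trib_list_eq:
  "trib_list k (trib_neg i) (trib_neg (i + 1)) (trib_neg (i + 2)) = map trib_neg [i..<i + k]"
proof (induction k arbitrary: i)
  case (Suc k)
  have upt: "[i..<i + Suc k] = i # [i + 1..<i + 1 + k]"
    by (subst upt_conv_Cons) simp_all
  have "trib_neg (i + 1 + 2) = trib_neg i - trib_neg (i + 1) - trib_neg (i + 2)"
    using trib_neg_rec[of i] by (simp only: add.assoc) simp
  moreover have "i + 1 + 1 = i + 2" by simp
  ultimately show ?case using Suc[of "i + 1"] unfolding upt by (simp only: trib_list.simps list.map)
qed simp

lemma trib_neg_values:
  "trib_neg 2 = 1" "trib_neg 3 = -1" "trib_neg 4 = 0" "trib_neg 5 = 2" "trib_neg 6 = -3"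
  "trib_neg 7 = 1" "trib_neg 8 = 4" "trib_neg 9 = -8" "trib_neg 10 = 5" "trib_neg 11 = 7"
  "trib_neg 12 = -20" "trib_neg 13 = 18" "trib_neg 14 = 9" "trib_neg 15 = -47"
  "trib_neg 16 = 56" "trib_neg 17 = 0" "trib_neg 18 = -103" "trib_neg 19 = 159"
  "trib_neg 20 = -56" "trib_neg 21 = -206"
proof -
  have "map trib_neg [0..<22] = trib_list 22 0 0 1"
  proof -
    have "trib_neg 0 = 0" "trib_neg (0 + 1) = 0" "trib_neg (0 + 2) = 1"
      by (simp_all add: numeral_2_eq_2)
    then show ?thesis using trib_list_eq[of 22 0] by (simp only: add_0)
  qed
  also have "\<dots> = [0, 0, 1, -1, 0, 2, -3, 1, 4, -8, 5, 7, -20, 18, 9, -47, 56, 0, -103, 159, -56, -206]"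
    by (simp add: eval_nat_numeral)
  finally have *: "map trib_neg [0..<22] = [0, 0, 1, -1, 0, 2, -3, 1, 4, -8, 5, 7, -20, 18, 9, -47, 56, 0, -103, 159, -56, -206]" .
  have nth: "trib_neg i = [0, 0, 1, -1, 0, 2, -3, 1, 4, -8, 5, 7, -20, 18, 9, -47, 56, 0, -103, 159, -56, -206] ! i"
    if "i < 22" for i
    using that nth_map_upt[of i 22 0 trib_neg] by (simp only: * diff_zero add_0)
  show "trib_neg 2 = 1" "trib_neg 3 = -1" "trib_neg 4 = 0" "trib_neg 5 = 2" "trib_neg 6 = -3"
    "trib_neg 7 = 1" "trib_neg 8 = 4" "trib_neg 9 = -8" "trib_neg 10 = 5" "trib_neg 11 = 7" "trib_neg 12 = -20"
    "trib_neg 13 = 18" "trib_neg 14 = 9" "trib_neg 15 = -47" "trib_neg 16 = 56" "trib_neg 17 = 0" "trib_neg 18 = -103"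
    "trib_neg 19 = 159" "trib_neg 20 = -56" "trib_neg 21 = -206"
    using nth[of 2] nth[of 3] nth[of 4] nth[of 5] nth[of 6] nth[of 7] nth[of 8]
     nth[of 9] nth[of 10] nth[of 11] nth[of 12] nth[of 13] nth[of 14] nth[of 15] nth[of 16]
     nth[of 17] nth[of 18] nth[of 19] nth[of 20] nth[of 21]
    by simp_all
qed

lemma multiplicity_2_of_cong:
  fixes x y :: int
  assumes "2 ^ Suc e dvd x - y" "y \<noteq> 0" "multiplicity 2 y = e"
  shows "multiplicity 2 x = e"
proof (rule multiplicity_eqI)
  have y: "2 ^ e dvd y" "\<not> 2 ^ Suc e dvd y"
    using assms by (auto simp: power_dvd_iff_le_multiplicity simp del: power_Suc)
  show "2 ^ e dvd x"
    using y(1) assms(1) by (metis dvd_diff_right_iff dvd_mult_right power_Suc dvd_add_right_iff diff_add_cancel)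
  show "\<not> 2 ^ Suc e dvd x"
    using y(2) assms(1) by (metis dvd_diff_left_iff dvd_diff_right_iff)
qed

lemma multiplicity_2_int: "multiplicity 2 (int n) = multiplicity 2 n"
proof (cases "n = 0")
  case False
  show ?thesis
  proof (rule multiplicity_eqI)
    have "2 ^ e dvd int n \<longleftrightarrow> 2 ^ e dvd n" for e
      by (metis of_nat_dvd_iff of_nat_numeral of_nat_power)
    moreover have "2 ^ multiplicity 2 n dvd n" "\<not> 2 ^ Suc (multiplicity 2 n) dvd n"
      using False by (auto simp: power_dvd_iff_le_multiplicity simp del: power_Suc)
    ultimately show "2 ^ multiplicity 2 n dvd int n" "\<not> 2 ^ Suc (multiplicity 2 n) dvd int n"
      by blast+
  qed
qed simp

lemma multiplicity_2_mult_int: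
  "a \<noteq> 0 \<Longrightarrow> b \<noteq> 0 \<Longrightarrow> multiplicity 2 (a * b :: int) = multiplicity 2 a + multiplicity 2 b"
  by (intro prime_elem_multiplicity_mult_distrib) auto

lemma multiplicity_2_mult_nat:
  "a \<noteq> 0 \<Longrightarrow> b \<noteq> 0 \<Longrightarrow> multiplicity 2 (a * b :: nat) = multiplicity 2 a + multiplicity 2 b"
  by (intro prime_elem_multiplicity_mult_distrib) auto

lemma choose_2_int: "2 * int (h choose 2) = int h * (int h - 1)"
  by (induction h) (simp_all add: numeral_2_eq_2 algebra_simps)

lemma odd_trib_neg: "odd (trib_neg (4 * h + 2))" "odd (trib_neg (4 * h + 3))"
proof -
  have "odd (trib_neg (4 * h + 2)) \<and> odd (trib_neg (4 * h + 3))"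
  proof (induction h)
    case (Suc h)
    have "4 * Suc h + 2 = (4 * h + 2) + 4" "4 * Suc h + 3 = (4 * h + 3) + 4" by simp_all
    then show ?case using Suc by (metis dvd_triv_left even_add trib_neg_shift_4)
  qed (simp add: trib_neg_values)
  then show "odd (trib_neg (4 * h + 2))" "odd (trib_neg (4 * h + 3))" by auto
qed

lemma funpow_2_3_4:
  "(g ^^ 2) x = g (g x)" "(g ^^ 3) x = g (g (g x))" "(g ^^ 4) x = g (g (g (g x)))"
  by (simp_all add: eval_nat_numeral)

text \<open>In the expansion at 0 the terms of index 0 and 1 vanish, the term of index 2 is $4\binom{h}{2} = 2h(h-1)$,
  and each later term is divisible by a higher power of 2.\<close>

lemma multiplicity_2_trib_neg_4h:
  assumes "2 \<le> h"
  shows "multiplicity 2 (trib_neg (4 * h)) = multiplicity 2 h + multiplicity 2 (h - 1) + 1"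
proof -
  define e where "e = multiplicity 2 (h * (h - 1))"
  have e: "e = multiplicity 2 h + multiplicity 2 (h - 1)"
    unfolding e_def using assms by (intro multiplicity_2_mult_nat) auto
  have "2 ^ (e + 2) dvd trib_neg (0 + 4 * h)
    - (\<Sum>i<3. 2 ^ i * int (h choose i) * (fdiff ^^ i) trib_neg 0)"
    unfolding e_def by (intro newton_step_4_cong trib_neg_shift_4 binomial_2_adic_pred)
  also have "(\<Sum>i<3. 2 ^ i * int (h choose i) * (fdiff ^^ i) trib_neg 0) = 4 * int (h choose 2)"
    by (simp add: lessThan_nat_numeral lessThan_Suc funpow_2_3_4 fdiff_def trib_neg_values)
  also have "4 * int (h choose 2) = 2 * int (h * (h - 1))"
    using choose_2_int[of h] assms by (simp add: of_nat_diff)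
  finally have "2 ^ Suc (e + 1) dvd trib_neg (4 * h) - 2 * int (h * (h - 1))" by simp
  moreover have "multiplicity 2 (2 * int (h * (h - 1))) = e + 1"
    using assms by (subst multiplicity_2_mult_int) (auto simp: e_def multiplicity_2_int simp del: of_nat_mult)
  ultimately show ?thesis using assms by (subst multiplicity_2_of_cong) (auto simp: e)
qed

text \<open>At a zero of $f$ the variable $h$ can be factored out of the expansion. The terms up to index 2 form a
  linear polynomial in $h$ times $2h$; the divisibility assumptions on the third and fourth differences
  make the terms of index 3 and 4 divisible by $2^{v(h)+4}$, as the later ones are without assumption.\<close>

lemma newton_step_4_near_zero:
  assumes "\<And>n. f (n + 4) = f n + 2 * fdiff f n"
    and "f n = 0" "2 dvd (fdiff ^^ 3) f n" "4 dvd (fdiff ^^ 4) f n"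
  shows "2 ^ (multiplicity 2 h + 4) dvd
    f (n + 4 * h) - 2 * int h * (fdiff f n + fdiff (fdiff f) n * (int h - 1))"
proof -
  let ?m = "2 ^ (multiplicity 2 h + 4) :: int"
  note dvd = power_multiplicity_dvd_mult_binomial
  have "2 ^ multiplicity 2 h dvd 2 ^ multiplicity 2 (3::nat) * int (h choose 3)"
    using dvd[of 3 h] by (intro power_dvd_if_dvd_mult) auto
  then have "2 ^ multiplicity 2 h dvd int (h choose 3)"
    by (simp add: not_dvd_imp_multiplicity_0)
  then have "2 ^ multiplicity 2 h * (8 * 2) dvd int (h choose 3) * (8 * (fdiff ^^ 3) f n)"
    using assms(3) by (intro mult_dvd_mono dvd_refl)
  then have 3: "?m dvd 2 ^ 3 * int (h choose 3) * (fdiff ^^ 3) f n"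
    by (simp add: power_add algebra_simps)
  have "2 ^ multiplicity 2 h * (4 * 4) dvd (4 * int (h choose 4)) * (4 * (fdiff ^^ 4) f n)"
    using assms(4) dvd[of 4 h] by (intro mult_dvd_mono dvd_refl) auto
  then have 4: "?m dvd 2 ^ 4 * int (h choose 4) * (fdiff ^^ 4) f n"
    by (simp add: power_add algebra_simps)
  have "?m dvd f (n + 4 * h) - (\<Sum>i<5. 2 ^ i * int (h choose i) * (fdiff ^^ i) f n)"
    by (intro newton_step_4_cong assms(1) binomial_2_adic)
  also have "(\<Sum>i<5. 2 ^ i * int (h choose i) * (fdiff ^^ i) f n) =
     2 * int h * fdiff f n + 2 * (2 * int (h choose 2)) * fdiff (fdiff f) n
     + 2 ^ 3 * int (h choose 3) * (fdiff ^^ 3) f n + 2 ^ 4 * int (h choose 4) * (fdiff ^^ 4) f n"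
    using assms(2) by (simp add: lessThan_nat_numeral lessThan_Suc funpow_2_3_4)
  finally have "?m dvd (f (n + 4 * h) -
    (2 * int h * fdiff f n + 2 * (2 * int (h choose 2)) * fdiff (fdiff f) n
     + 2 ^ 3 * int (h choose 3) * (fdiff ^^ 3) f n + 2 ^ 4 * int (h choose 4) * (fdiff ^^ 4) f n))
     + 2 ^ 3 * int (h choose 3) * (fdiff ^^ 3) f n + 2 ^ 4 * int (h choose 4) * (fdiff ^^ 4) f n"
    using 3 4 by (intro dvd_add)
  then show ?thesis unfolding choose_2_int by (simp add: algebra_simps)
qed

text \<open>The precision of four binary digits beyond $v(h)$ determines the valuation as long as the
  cofactor $c$ is not divisible by 8.\<close>

lemma multiplicity_2_near_zero:
  assumes "2 ^ (multiplicity 2 h + 4) dvd x - 2 * int h * c" "h \<noteq> 0"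
    "2 ^ e dvd c" "\<not> 2 ^ Suc e dvd c" "e \<le> 2"
  shows "multiplicity 2 x = multiplicity 2 h + e + 1"
proof (rule multiplicity_2_of_cong)
  show "2 ^ Suc (multiplicity 2 h + e + 1) dvd x - 2 * int h * c"
    using assms(1) by (rule dvd_trans[rotated]) (use assms(5) in \<open>simp add: le_imp_power_dvd flip: power_Suc\<close>)
  have "c \<noteq> 0" using assms(4) by auto
  moreover have "multiplicity 2 c = e" using assms(3,4) by (intro multiplicity_eqI)
  ultimately show "2 * int h * c \<noteq> 0" "multiplicity 2 (2 * int h * c) = multiplicity 2 h + e + 1"
    using assms(2) by (auto simp: multiplicity_2_mult_int multiplicity_2_int)
qed

text \<open>The indices congruent to 1 modulo 4 contain two zeros, $T_{-1}$ and $T_{-17}$, that is, $h = 0$ and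
  $h = 4$. Expanding at the first gives the cofactor $4 - 3h$, which is a multiple of 8 exactly if
  $h \equiv 4$ modulo 8. These $h$ are 2-adically close to the second zero, and the expansion there
  settles them.\<close>

lemma multiplicity_2_trib_neg_4h_plus_1:
  assumes "5 \<le> h"
  shows "multiplicity 2 (trib_neg (4 * h + 1)) = multiplicity 2 h + multiplicity 2 (h - 4) + 1"
proof (cases "h mod 8 = 4")
  case True
  define q where "q = h div 8"
  have q: "h = 8 * q + 4" "q \<noteq> 0"
    using True assms div_mult_mod_eq[of h 8] unfolding q_def by auto
  define g where "g = 8 * q"
  have g: "h = g + 4" "h - 4 = g" "g \<noteq> 0" unfolding g_def using q by auto
  have "fdiff trib_neg 17 = -103" "fdiff (fdiff trib_neg) 17 = 365"
    "(fdiff ^^ 3) trib_neg 17 = -842" "(fdiff ^^ 4) trib_neg 17 = 1384"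
    by (simp_all add: funpow_2_3_4 fdiff_def trib_neg_values)
  then have "2 ^ (multiplicity 2 g + 4) dvd trib_neg (17 + 4 * g)
      - 2 * int g * (365 * int g - 468)"
    using newton_step_4_near_zero[OF trib_neg_shift_4, of 17 g]
    by (simp add: trib_neg_values algebra_simps)
  then have "multiplicity 2 (trib_neg (17 + 4 * g)) = multiplicity 2 g + 2 + 1"
  proof (rule multiplicity_2_near_zero)
    have c: "365 * int g - 468 = 4 * (730 * int q - 117)" unfolding g_def by simp
    show "2 ^ 2 dvd 365 * int g - 468" unfolding c by simp
    have "odd (730 * int q - 117)" by simp
    then show "\<not> 2 ^ Suc 2 dvd 365 * int g - 468"
      unfolding c by (metis dvd_mult_cancel_left mult_2_right numeral_Bit0 power2_eq_square
        power_Suc2 zero_neq_numeral mult_2)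
  qed (use g in auto)
  moreover have "multiplicity 2 h = 2"
  proof (rule multiplicity_eqI)
    have "h = 4 * (2 * q + 1)" using q by simp
    then show "2 ^ 2 dvd h" by simp
    show "\<not> 2 ^ Suc 2 dvd h" using True by (simp add: dvd_eq_mod_eq_0)
  qed
  moreover have "4 * h + 1 = 17 + 4 * g" using g by simp
  ultimately show ?thesis using g(2) by simp
next
  case False
  have "fdiff trib_neg 1 = 1" "fdiff (fdiff trib_neg) 1 = -3"
    "(fdiff ^^ 3) trib_neg 1 = 6" "(fdiff ^^ 4) trib_neg 1 = -8"
    by (simp_all add: funpow_2_3_4 fdiff_def trib_neg_values)
  then have cong: "2 ^ (multiplicity 2 h + 4) dvd trib_neg (1 + 4 * h)
      - 2 * int h * (4 - 3 * int h)"
    using newton_step_4_near_zero[OF trib_neg_shift_4, of 1 h]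
    by (simp add: trib_neg_values algebra_simps)
  \<comment> \<open>Away from 4 modulo 8 the cofactor and the distance to the other zero have the same valuation.\<close>
  have "\<exists>e\<le>2. 2 ^ e dvd 4 - 3 * int h \<and> \<not> 2 ^ Suc e dvd 4 - 3 * int h
      \<and> 2 ^ e dvd int h - 4 \<and> \<not> 2 ^ Suc e dvd int h - 4"
  proof -
    have "odd h \<or> h mod 4 = 2 \<or> h mod 8 = 0" using False by presburger
    then show ?thesis
    proof (elim disjE)
      assume "odd h"
      then show ?thesis by (intro exI[of _ 0]) simp
    next
      assume "h mod 4 = 2"
      then have "int h mod 4 = 2" by (metis of_nat_mod of_nat_numeral)
      then have "2 dvd 4 - 3 * int h" "\<not> 4 dvd 4 - 3 * int h" "2 dvd int h - 4" "\<not> 4 dvd int h - 4"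
        by presburger+
      then show ?thesis by (intro exI[of _ 1]) simp
    next
      assume "h mod 8 = 0"
      then have "int h mod 8 = 0" by (metis of_nat_mod of_nat_numeral of_nat_0)
      then have "4 dvd 4 - 3 * int h" "\<not> 8 dvd 4 - 3 * int h" "4 dvd int h - 4" "\<not> 8 dvd int h - 4"
        by presburger+
      then show ?thesis by (intro exI[of _ 2]) simp
    qed
  qed
  then obtain e where e: "e \<le> 2" "2 ^ e dvd 4 - 3 * int h" "\<not> 2 ^ Suc e dvd 4 - 3 * int h"
    "2 ^ e dvd int h - 4" "\<not> 2 ^ Suc e dvd int h - 4"
    by blast
  have "multiplicity 2 (trib_neg (1 + 4 * h)) = multiplicity 2 h + e + 1"
    by (rule multiplicity_2_near_zero[OF cong _ e(2,3,1)]) (use assms in auto)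
  moreover have "multiplicity 2 (int (h - 4)) = e"
    using e(4,5) assms by (intro multiplicity_eqI) (auto simp: of_nat_diff)
  ultimately show ?thesis by (simp add: multiplicity_2_int add.commute)
qed

section \<open>Valuations at 2 of factorials and of products of consecutive terms\<close>

lemma multiplicity_2_fact_double: "multiplicity 2 (fact (2 * h) :: nat) = h + multiplicity 2 (fact h :: nat)"
proof (induction h)
  case (Suc h)
  have "(fact (2 * Suc h) :: nat) = (2 * h + 1) * (2 * (Suc h * fact (2 * h)))"
    by (simp add: algebra_simps)
  also have "multiplicity 2 \<dots> = 1 + (multiplicity 2 (Suc h) + multiplicity 2 (fact (2 * h) :: nat))"
    by (simp add: multiplicity_2_mult_nat not_dvd_imp_multiplicity_0 del: mult_Suc mult_Suc_right)
  also have "\<dots> = Suc h + (multiplicity 2 (Suc h) + multiplicity 2 (fact h :: nat))"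
    using Suc by simp
  also have "multiplicity 2 (Suc h) + multiplicity 2 (fact h :: nat) = multiplicity 2 (fact (Suc h) :: nat)"
    by (simp add: multiplicity_2_mult_nat del: mult_Suc)
  finally show ?case .
qed simp

text \<open>Recursive form of Legendre's formula.\<close>

lemma multiplicity_2_fact:
  "multiplicity 2 (fact m :: nat) = m div 2 + multiplicity 2 (fact (m div 2) :: nat)"
proof (cases "even m")
  case True
  then show ?thesis using multiplicity_2_fact_double[of "m div 2"] by simp
next
  case False
  then obtain h where h: "m = Suc (2 * h)" using oddE by (metis Suc_eq_plus1)
  have "multiplicity 2 (fact m :: nat) = multiplicity 2 (fact (2 * h) :: nat)"
    unfolding h fact_Suc of_nat_id
    by (subst multiplicity_2_mult_nat) (auto simp: not_dvd_imp_multiplicity_0)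
  then show ?thesis using multiplicity_2_fact_double[of h] h by simp
qed

lemma multiplicity_2_fact_less: "1 \<le> m \<Longrightarrow> multiplicity 2 (fact m :: nat) < m"
proof (induction m rule: less_induct)
  case (less m)
  show ?case
  proof (cases "m = 1")
    case False
    then have "multiplicity 2 (fact (m div 2) :: nat) < m div 2"
      using less.prems by (intro less.IH) auto
    then show ?thesis using multiplicity_2_fact[of m] by linarith
  qed simp
qed

lemma multiplicity_2_fact_ge: "m < 2 ^ k \<Longrightarrow> m \<le> multiplicity 2 (fact m :: nat) + k"
proof (induction k arbitrary: m)
  case (Suc k)
  then have "m div 2 \<le> multiplicity 2 (fact (m div 2) :: nat) + k" by (intro Suc.IH) auto
  then show ?case using multiplicity_2_fact[of m] by linarith
qed simp

lemma multiplicity_2_fact_eq_sum: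
  "multiplicity 2 (fact m :: nat) = (\<Sum>h=1..m. multiplicity 2 h)"
  by (induction m) (simp_all add: multiplicity_2_mult_nat del: mult_Suc)

text \<open>By Legendre's formula the sum is the difference of the valuations of $b!$ and $(a-1)!$, which equal
  $b$ and $a - 1$ up to the number of binary ones. The error term depends only on the lower end $a$.\<close>

lemma sum_multiplicity_2_le:
  fixes a b :: nat
  assumes "1 \<le> a" "a \<le> b" "a \<le> 2 ^ k"
  shows "(\<Sum>h=a..b. multiplicity 2 h) \<le> b - a + k"
proof -
  have "{1..b} = {1..a - 1} \<union> {a..b}" "{1..a - 1} \<inter> {a..b} = {}" using assms by auto
  then have "(\<Sum>h=1..b. multiplicity 2 h) = (\<Sum>h=1..a - 1. multiplicity 2 h) + (\<Sum>h=a..b. multiplicity 2 h)"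
    by (simp add: sum.union_disjoint)
  moreover have "(\<Sum>h=1..b. multiplicity 2 h) < b"
    using multiplicity_2_fact_less[of b] assms by (simp add: multiplicity_2_fact_eq_sum)
  moreover have "a - 1 \<le> (\<Sum>h=1..a - 1. multiplicity 2 h) + k"
    using multiplicity_2_fact_ge[of "a - 1" k] assms by (simp add: multiplicity_2_fact_eq_sum)
  ultimately show ?thesis using assms by linarith
qed

lemma sum_multiplicity_2_shifted_le:
  fixes a b c :: nat
  assumes "c < a" "a \<le> b" "a \<le> 2 ^ k"
  shows "(\<Sum>h=a..b. multiplicity 2 h + multiplicity 2 (h - c) + 1) \<le> 3 * (b - a) + 1 + 2 * k"
proof -
  have "(\<Sum>h=a..b. multiplicity 2 (h - c)) = (\<Sum>h=(a - c) + c..(b - c) + c. multiplicity 2 (h - c))"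
    using assms by simp
  also have "\<dots> = (\<Sum>h=a - c..b - c. multiplicity 2 h)"
    by (subst sum.shift_bounds_cl_nat_ivl) simp
  also have "\<dots> \<le> (b - c) - (a - c) + k" by (rule sum_multiplicity_2_le) (use assms in auto)
  finally have "(\<Sum>h=a..b. multiplicity 2 (h - c)) \<le> b - a + k" using assms by simp
  moreover have "(\<Sum>h=a..b. multiplicity 2 h) \<le> b - a + k"
    by (rule sum_multiplicity_2_le) (use assms in auto)
  ultimately show ?thesis using assms unfolding sum.distrib by simp
qed

text \<open>The terms of index $4h$ and $4h+1$ contribute three per index on average, and each of the four
  factors $h$, $h-1$, $h$, $h-4$ contributes one logarithmic error $k$. The assumption on $n$ keeps the
  window to the right of the zero $T_{-17}$.\<close>

lemma sum_multiplicity_2_trib_neg_le: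
  assumes "18 \<le> n" "n \<le> N" "n \<le> 4 * 2 ^ k"
  shows "(\<Sum>j=n..N. multiplicity 2 (trib_neg j)) \<le> 3 * ((N - n + 1) div 2) + 2 + 4 * k"
proof -
  let ?v = "\<lambda>j. multiplicity 2 (trib_neg j)"
  define a b c d where a_b_c_d_def: "a = (n + 3) div 4" "b = N div 4" "c = (n + 2) div 4" "d = (N - 1) div 4"
  have abcd: "n \<le> 4 * a" "4 * a \<le> n + 3" "4 * b \<le> N" "N \<le> 4 * b + 3"
    "n \<le> 4 * c + 1" "4 * c \<le> n + 2" "4 * d + 1 \<le> N" "N \<le> 4 * d + 4"
    unfolding a_b_c_d_def using assms by linarith+
  have "(\<Sum>j=n..N. ?v j) = (\<Sum>j\<in>(\<lambda>h. 4 * h) ` {a..b} \<union> (\<lambda>h. 4 * h + 1) ` {c..d}. ?v j)"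
  proof (rule sum.mono_neutral_right)
    show "(\<lambda>h. 4 * h) ` {a..b} \<union> (\<lambda>h. 4 * h + 1) ` {c..d} \<subseteq> {n..N}"
      using abcd by auto
    show "\<forall>j\<in>{n..N} - ((\<lambda>h. 4 * h) ` {a..b} \<union> (\<lambda>h. 4 * h + 1) ` {c..d}). ?v j = 0"
    proof
      fix j assume j: "j \<in> {n..N} - ((\<lambda>h. 4 * h) ` {a..b} \<union> (\<lambda>h. 4 * h + 1) ` {c..d})"
      have "j \<noteq> 4 * h" for h
      proof
        assume "j = 4 * h"
        moreover from this have "h \<in> {a..b}" using j abcd by auto
        ultimately show False using j by blast
      qed
      moreover have "j \<noteq> 4 * h + 1" for h
      proof
        assume "j = 4 * h + 1"
        moreover from this have "h \<in> {c..d}" using j abcd by auto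
        ultimately show False using j by blast
      qed
      moreover have "j = 4 * (j div 4) \<or> j = 4 * (j div 4) + 1 \<or> j = 4 * (j div 4) + 2 \<or> j = 4 * (j div 4) + 3"
        by presburger
      ultimately have "odd (trib_neg j)" using odd_trib_neg by metis
      then show "?v j = 0" by (rule not_dvd_imp_multiplicity_0)
    qed
  qed simp
  also have "\<dots> = (\<Sum>h=a..b. ?v (4 * h)) + (\<Sum>h=c..d. ?v (4 * h + 1))"
  proof (subst sum.union_disjoint)
    show "(\<lambda>h. 4 * h) ` {a..b} \<inter> (\<lambda>h. 4 * h + 1) ` {c..d} = {}"
    proof -
      have "4 * h \<noteq> 4 * i + 1" for h i :: nat by presburger
      then show ?thesis by blast
    qed
  qed (auto simp: sum.reindex inj_on_def)
  also have "(\<Sum>h=a..b. ?v (4 * h)) = (\<Sum>h=a..b. multiplicity 2 h + multiplicity 2 (h - 1) + 1)"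
    using assms abcd by (intro sum.cong multiplicity_2_trib_neg_4h) auto
  also have "(\<Sum>h=c..d. ?v (4 * h + 1)) = (\<Sum>h=c..d. multiplicity 2 h + multiplicity 2 (h - 4) + 1)"
    using assms abcd by (intro sum.cong multiplicity_2_trib_neg_4h_plus_1) auto
  also have "(\<Sum>h=a..b. multiplicity 2 h + multiplicity 2 (h - 1) + 1) \<le> 3 * (b - a) + 1 + 2 * k"
  proof (cases "a \<le> b")
    case True
    then show ?thesis using assms abcd by (intro sum_multiplicity_2_shifted_le) linarith+
  qed simp
  also have "(\<Sum>h=c..d. multiplicity 2 h + multiplicity 2 (h - 4) + 1) \<le> 3 * (d - c) + 1 + 2 * k"
  proof (cases "c \<le> d")
    case True
    then show ?thesis using assms abcd by (intro sum_multiplicity_2_shifted_le) linarith+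
  qed simp
  also have "3 * (b - a) + 1 + 2 * k + (3 * (d - c) + 1 + 2 * k) \<le> 3 * ((N - n + 1) div 2) + 2 + 4 * k"
  proof -
    have "4 * (b - a) \<le> N - n" "4 * (d - c) \<le> N - n" using abcd assms by linarith+
    then have "(b - a) + (d - c) \<le> (N - n + 1) div 2" by linarith
    then show ?thesis by simp
  qed
  finally show ?thesis by simp
qed

text \<open>Arithmetic and geometric mean of $1, \ldots, m$, with $i$ paired with $m + 1 - i$.\<close>

lemma fact_double_power_le: "2 ^ m * fact m \<le> (m + 1) ^ m"
  for m :: nat
proof -
  have "(fact m)\<^sup>2 = (\<Prod>i=1..m. i * (m + 1 - i))"
  proof -
    have "(\<Prod>i=1..m. m + 1 - i) = (\<Prod>i=1..m. i)"
      by (rule prod.reindex_bij_witness[of _ "\<lambda>i. m + 1 - i" "\<lambda>i. m + 1 - i"]) auto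
    then show ?thesis by (simp add: prod.distrib power2_eq_square fact_prod)
  qed
  then have "(2 ^ m * fact m)\<^sup>2 = (\<Prod>i=1..m. 4 * (i * (m + 1 - i)))"
  proof -
    have "(4::nat) ^ m = 2 ^ m * 2 ^ m" by (simp flip: power_mult_distrib)
    then have "(2 ^ m * fact m :: nat)\<^sup>2 = 4 ^ m * (fact m)\<^sup>2"
      by (simp add: power2_eq_square mult_ac)
    then show ?thesis unfolding \<open>(fact m)\<^sup>2 = _\<close> by (simp add: prod.distrib)
  qed
  also have "\<dots> \<le> (\<Prod>i=1..m. (m + 1)\<^sup>2)"
  proof (rule prod_mono, safe)
    fix i assume "i \<in> {1..m}"
    then obtain j where j: "m + 1 = i + j" using le_Suc_ex[of i "m + 1"] by auto
    have "4 * (int i * int j) \<le> (int i + int j)\<^sup>2"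
      using zero_le_power2[of "int i - int j"] by (simp add: power2_eq_square algebra_simps)
    then have "int (4 * (i * j)) \<le> int ((i + j)\<^sup>2)" by simp
    then have "4 * (i * j) \<le> (i + j)\<^sup>2" by (simp only: of_nat_le_iff)
    then show "4 * (i * (m + 1 - i)) \<le> (m + 1)\<^sup>2" unfolding j by simp
  qed
  also have "\<dots> = ((m + 1) ^ m)\<^sup>2" by (simp add: mult.commute flip: power_mult)
  finally show ?thesis by (rule power2_le_imp_le) simp
qed

text \<open>The factor $2^m$ saved by the arithmetic-geometric mean pays for the at most $\log_2(m+1)$ factors
  by which $m$ exceeds the valuation of $m!$, since $(m+1)^k \le 2^{k^2} \le 2^m$.\<close>

lemma fact_le_power_multiplicity_2:
  fixes m :: nat
  assumes "64 \<le> m"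
  shows "fact m \<le> (m + 1) ^ multiplicity 2 (fact m :: nat)" "m + 1 \<le> 2 * multiplicity 2 (fact m :: nat)"
proof -
  define k where "k = (LEAST k. m < 2 ^ k)"
  have k: "m < 2 ^ k" unfolding k_def by (rule LeastI[of _ m]) simp
  \<comment> \<open>From 7 on, $k^2 \<le> 2^{k-1}$; at 6 this fails, whence the bound 64 on $m$.\<close>
  have sq: "Suc (t + 7) ^ 2 \<le> 2 ^ (t + 7)" for t :: nat
    by (induction t) (auto simp: power2_eq_square power_add algebra_simps)
  have "k > 6"
  proof (rule ccontr)
    assume "\<not> k > 6"
    then have "(2::nat) ^ k \<le> 2 ^ 6" by (intro power_increasing) auto
    then show False using k assms by simp
  qed
  then have "2 ^ (k - 1) \<le> m" using not_less_Least[of "k - 1" "\<lambda>k. m < 2 ^ k"] unfolding k_def by linarith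
  moreover have "k\<^sup>2 \<le> 2 ^ (k - 1)"
  proof (cases "k = 7")
    case False
    then show ?thesis using sq[of "k - 8"] \<open>k > 6\<close> by simp
  qed simp
  ultimately have km: "k\<^sup>2 \<le> m" by linarith
  have v: "m \<le> multiplicity 2 (fact m :: nat) + k" by (rule multiplicity_2_fact_ge[OF k])
  have "7 * k \<le> k * k" using \<open>k > 6\<close> by (intro mult_right_mono) auto
  then have "7 * k \<le> m" using km unfolding power2_eq_square by linarith
  then show "m + 1 \<le> 2 * multiplicity 2 (fact m :: nat)" using v assms by linarith
  have "2 ^ m * fact m \<le> (m + 1) ^ m" by (rule fact_double_power_le)
  also have "\<dots> \<le> (m + 1) ^ (multiplicity 2 (fact m :: nat) + k)" using v by (intro power_increasing) auto
  also have "\<dots> = (m + 1) ^ multiplicity 2 (fact m :: nat) * (m + 1) ^ k" by (rule power_add)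
  also have "(m + 1) ^ k \<le> (2 ^ k) ^ k" using k by (intro power_mono) auto
  also have "(2 ^ k) ^ k = (2::nat) ^ k\<^sup>2" by (simp add: power2_eq_square flip: power_mult)
  also have "\<dots> \<le> 2 ^ m" using km by (intro power_increasing) auto
  finally show "fact m \<le> (m + 1) ^ multiplicity 2 (fact m :: nat)" by simp
qed

text \<open>$c^{v(n)}$ for the valuation $v$ at 2, in a form that evaluates by repeated halving;
  the value 1 at 0 is a default.\<close>

fun val_pow :: "nat \<Rightarrow> nat \<Rightarrow> nat" where
  "val_pow c n = (if n = 0 \<or> odd n then 1 else c * val_pow c (n div 2))"

declare val_pow.simps [simp del]

lemma val_pow_eq: "0 < n \<Longrightarrow> val_pow c n = c ^ multiplicity 2 n"
proof (induction n rule: less_induct)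
  case (less n)
  show ?case
  proof (cases "odd n")
    case True
    then show ?thesis by (subst val_pow.simps) (simp add: not_dvd_imp_multiplicity_0)
  next
    case False
    then obtain h where h: "n = 2 * h" by blast
    then show ?thesis using less by (subst val_pow.simps) (simp add: multiplicity_2_mult_nat)
  qed
qed

text \<open>Runs through the factorials $f$ together with the powers $y$ of 47, so that each step costs one
  multiplication.\<close>

fun fact_chain :: "nat list \<Rightarrow> nat \<Rightarrow> nat \<Rightarrow> bool" where
  "fact_chain [] f y = (f \<le> y)"
| "fact_chain (m # ms) f y = (f \<le> y \<and> fact_chain ms (m * f) (val_pow 47 m * y))"

lemma fact_chain:
  assumes "fact_chain [Suc i..<Suc j] (fact i) (47 ^ multiplicity 2 (fact i :: nat))" "i \<le> m" "m \<le> j"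
  shows "fact m \<le> (47 :: nat) ^ multiplicity 2 (fact m :: nat)"
  using assms
proof (induction "j - i" arbitrary: i)
  case 0
  then have "i = m" "j = m" by simp_all
  then show ?case using 0 by simp
next
  case (Suc d)
  then have "i < j" by simp
  then have upt: "[Suc i..<Suc j] = Suc i # [Suc (Suc i)..<Suc j]" by (intro upt_conv_Cons) simp
  have step: "47 ^ multiplicity 2 (fact (Suc i) :: nat) = val_pow 47 (Suc i) * 47 ^ multiplicity 2 (fact i :: nat)"
    by (simp add: val_pow_eq multiplicity_2_mult_nat power_add del: mult_Suc)
  have chain: "fact i \<le> (47 :: nat) ^ multiplicity 2 (fact i :: nat)"
    "fact_chain [Suc (Suc i)..<Suc j] (fact (Suc i)) (47 ^ multiplicity 2 (fact (Suc i) :: nat))"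
    using Suc.prems(1) unfolding upt step by simp_all
  show ?case
  proof (cases "m = i")
    case False
    then have "d = j - Suc i" "Suc i \<le> m" using Suc.hyps(2) Suc.prems(2) by simp_all
    then show ?thesis using Suc.hyps(1) chain(2) Suc.prems(3) by blast
  qed (use chain in simp)
qed

text \<open>The largest value of $(m!)^{1/v(m!)}$ for $2 \le m \le 102$ is slightly above 46, which determines
  the constant 47.\<close>

lemma fact_le_47_power:
  assumes "m \<le> 102"
  shows "fact m \<le> (47::nat) ^ multiplicity 2 (fact m :: nat)"
proof (cases "m = 0")
  case False
  have "fact_chain [2..<103] 1 1" by (simp add: val_pow.simps)
  moreover have "fact 1 = (1::nat)" "(47::nat) ^ multiplicity 2 (fact 1 :: nat) = 1"
    "Suc 1 = 2" "Suc 102 = 103" by simp_all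
  ultimately have "fact_chain [Suc 1..<Suc 102] (fact 1) (47 ^ multiplicity 2 (fact 1 :: nat))"
    by (simp only:)
  then show ?thesis by (rule fact_chain) (use assms False in auto)
qed simp

section \<open>Growth of products of consecutive terms\<close>

lemma small_root_exists:
  obtains \<rho> :: real where "\<rho> ^ 3 + \<rho>\<^sup>2 + \<rho> = 1" "0.543 < \<rho>" "\<rho> < 0.544"
proof -
  have "\<exists>x\<ge>0.543. x \<le> 0.544 \<and> x ^ 3 + x\<^sup>2 + x = (1::real)"
    by (rule IVT') (auto simp: power2_eq_square power3_eq_cube intro!: continuous_intros)
  then obtain x :: real where x: "0.543 \<le> x" "x \<le> 0.544" "x ^ 3 + x\<^sup>2 + x = 1" by blast
  moreover have "(0.543::real) ^ 3 + 0.543\<^sup>2 + 0.543 \<noteq> 1" "(0.544::real) ^ 3 + 0.544\<^sup>2 + 0.544 \<noteq> 1"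
    by (simp_all add: power2_eq_square power3_eq_cube)
  then have "x \<noteq> 0.543" "x \<noteq> 0.544" using x(3) by blast+
  ultimately show ?thesis by (intro that[of x]) (auto simp: less_le)
qed

text \<open>The polynomial $x^3 + x^2 + x - 1$ has the real root $\rho = 0.5436\ldots$ and a pair of complex
  roots that are the zeros of $x^2 + (1 + \rho) x + \tau$, with $\tau = 1/\rho$.\<close>

context
  fixes \<rho> \<tau> :: real
  assumes root: "\<rho> ^ 3 + \<rho>\<^sup>2 + \<rho> = 1"
    and lower: "0.543 < \<rho>" and upper: "\<rho> < 0.544"
    and tau: "\<tau> = 1 + \<rho> + \<rho>\<^sup>2"
begin

lemma rho_tau: "\<rho> * \<tau> = 1"
  using root by (simp add: tau algebra_simps power2_eq_square power3_eq_cube)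

text \<open>Applying the quadratic factor to the sequence removes the complex roots; what is left is
  geometric with ratio $\rho$ and therefore tiny.\<close>

lemma trib_neg_contracting_part:
  "trib_neg (n + 2) + (1 + \<rho>) * trib_neg (n + 1) + \<tau> * trib_neg n = \<rho> ^ n"
proof (induction n)
  case 0
  show ?case by (simp add: trib_neg_values)
next
  case (Suc n)
  have "trib_neg (Suc n + 2) = - trib_neg (n + 2) - trib_neg (n + 1) + trib_neg n"
    using trib_neg_rec[of n] by (simp add: eval_nat_numeral)
  then have "trib_neg (Suc n + 2) + (1 + \<rho>) * trib_neg (Suc n + 1) + \<tau> * trib_neg (Suc n)
      = \<rho> * trib_neg (n + 2) + (\<tau> - 1) * trib_neg (n + 1) + (\<rho> * \<tau>) * trib_neg n"
    unfolding rho_tau by (simp add: algebra_simps)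
  also have "\<dots> = \<rho> * (trib_neg (n + 2) + (1 + \<rho>) * trib_neg (n + 1) + \<tau> * trib_neg n)"
    by (simp add: tau algebra_simps power2_eq_square)
  finally show ?case using Suc by simp
qed

text \<open>Applying the linear factor removes the real root; what is left satisfies the second-order recurrence of
  the complex roots.\<close>

definition trib_osc :: "nat \<Rightarrow> real" where
  "trib_osc n = trib_neg (n + 1) - \<rho> * trib_neg n"

text \<open>The left-hand side is the norm form of the quadratic factor; one step multiplies it by
  the norm $\tau$ of a complex root.\<close>

lemma trib_osc_norm:
  "(trib_osc (n + 1))\<^sup>2 + (1 + \<rho>) * trib_osc n * trib_osc (n + 1) + \<tau> * (trib_osc n)\<^sup>2 = \<tau> ^ n"
proof (induction n)
  case 0
  show ?case by (simp add: trib_osc_def trib_neg_values flip: numeral_2_eq_2)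
next
  case (Suc n)
  have r: "trib_neg (n + 3) = - trib_neg (n + 2) - trib_neg (n + 1) + trib_neg n"
    by (rule trib_neg_rec)
  have "trib_osc (n + 2) = real_of_int (trib_neg (n + 3)) - \<rho> * trib_neg (n + 2)"
    by (simp add: trib_osc_def eval_nat_numeral)
  also have "\<dots> = - (1 + \<rho>) * (trib_neg (n + 2) - \<rho> * trib_neg (n + 1))
      - (\<tau> * trib_neg (n + 1) - (\<rho> * \<tau>) * trib_neg n)"
    unfolding r rho_tau by (simp add: tau algebra_simps power2_eq_square)
  finally have step: "trib_osc (n + 2) = - (1 + \<rho>) * trib_osc (n + 1) - \<tau> * trib_osc n"
    by (simp add: trib_osc_def algebra_simps)
  have "(trib_osc (n + 2))\<^sup>2 + (1 + \<rho>) * trib_osc (n + 1) * trib_osc (n + 2) + \<tau> * (trib_osc (n + 1))\<^sup>2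
     = \<tau> * ((trib_osc (n + 1))\<^sup>2 + (1 + \<rho>) * trib_osc n * trib_osc (n + 1) + \<tau> * (trib_osc n)\<^sup>2)"
    unfolding step by (simp add: algebra_simps power2_eq_square)
  then show ?case using Suc by simp
qed

text \<open>Because the contracting part is tiny, $T_{-n-2}$ is essentially a combination of $T_{-n}$ and
  $T_{-n-1}$, so the norm form is bounded in terms of these two alone.\<close>

lemma power_le_consecutive_trib_neg:
  assumes "4 \<le> n" "\<bar>real_of_int (trib_neg n)\<bar> \<le> X" "\<bar>real_of_int (trib_neg (n + 1))\<bar> \<le> X" "1 \<le> X"
  shows "\<tau> ^ n \<le> 32 * X\<^sup>2"
proof -
  define a b where "a = real_of_int (trib_neg n)" "b = real_of_int (trib_neg (n + 1))"
  have tau_bds: "0 < \<tau>" "\<tau> \<le> 1.84"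
  proof -
    show "0 < \<tau>" unfolding tau using lower by (intro add_pos_nonneg) auto
    have "\<rho> * \<rho> \<le> 0.544 * 0.544" using lower upper by (intro mult_mono) auto
    then show "\<tau> \<le> 1.84" unfolding tau power2_eq_square using upper by simp
  qed
  have "\<rho> ^ n \<le> \<rho> ^ 4" using assms(1) lower upper by (intro power_decreasing) auto
  also have "\<dots> \<le> 0.544 ^ 4" using lower upper by (intro power_mono) auto
  also have "\<dots> \<le> (0.1 :: real)" by (simp add: eval_nat_numeral)
  finally have e: "\<rho> ^ n \<le> 0.1" .
  have y: "\<bar>trib_osc n\<bar> \<le> 1.544 * X"
  proof -
    have "\<bar>trib_osc n\<bar> \<le> \<bar>b\<bar> + \<bar>\<rho> * a\<bar>" unfolding trib_osc_def a_b_def by linarith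
    moreover have "\<bar>\<rho> * a\<bar> \<le> 0.544 * X" unfolding abs_mult
      using assms(2) lower upper by (intro mult_mono) (auto simp: a_b_def)
    moreover have "\<bar>b\<bar> \<le> X" using assms(3) by (simp add: a_b_def)
    ultimately show ?thesis by simp
  qed
  have z: "\<bar>trib_osc (n + 1)\<bar> \<le> 4.03 * X"
  proof -
    have rho_pos: "0 \<le> \<rho> ^ n" using lower by simp
    have "trib_osc (n + 1) = \<rho> ^ n - (1 + 2 * \<rho>) * b - \<tau> * a"
      using trib_neg_contracting_part[of n] unfolding trib_osc_def a_b_def
      by (simp add: algebra_simps)
    then have "\<bar>trib_osc (n + 1)\<bar> \<le> \<rho> ^ n + \<bar>(1 + 2 * \<rho>) * b\<bar> + \<bar>\<tau> * a\<bar>"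
      using rho_pos by linarith
    moreover have "\<bar>(1 + 2 * \<rho>) * b\<bar> \<le> 2.088 * X" unfolding abs_mult
      using assms(3) lower upper by (intro mult_mono) (auto simp: a_b_def)
    moreover have "\<bar>\<tau> * a\<bar> \<le> 1.84 * X" unfolding abs_mult
      using assms(2) tau_bds by (intro mult_mono) (auto simp: a_b_def)
    ultimately show ?thesis using e assms(4) by simp
  qed
  have y2: "(trib_osc n)\<^sup>2 \<le> (1.544 * X)\<^sup>2" and z2: "(trib_osc (n + 1))\<^sup>2 \<le> (4.03 * X)\<^sup>2"
    using y z assms(4) by (intro abs_le_square_iff[THEN iffD1]; simp)+
  have yz: "\<bar>(1 + \<rho>) * trib_osc n * trib_osc (n + 1)\<bar> \<le> 1.544 * (1.544 * X) * (4.03 * X)"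
    unfolding abs_mult using y z lower upper assms(4) by (intro mult_mono) auto
  have t: "\<tau> * (trib_osc n)\<^sup>2 \<le> 1.84 * (1.544 * X)\<^sup>2"
    using tau_bds y2 by (intro mult_mono) auto
  have "\<tau> ^ n = (trib_osc (n + 1))\<^sup>2 + (1 + \<rho>) * trib_osc n * trib_osc (n + 1) + \<tau> * (trib_osc n)\<^sup>2"
    by (rule trib_osc_norm[symmetric])
  also have "\<dots> \<le> (4.03 * X)\<^sup>2 + 1.544 * (1.544 * X) * (4.03 * X) + 1.84 * (1.544 * X)\<^sup>2"
    using abs_ge_self[of "(1 + \<rho>) * trib_osc n * trib_osc (n + 1)"] yz
    by (intro add_mono z2 t) (rule order_trans)
  also have "\<dots> \<le> 32 * X\<^sup>2"
    by (simp add: power2_eq_square)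
  finally show ?thesis .
qed

text \<open>Makes it possible to compare powers of $\tau$ with powers of 2 in integers.\<close>

lemma tau_power_8: "2 ^ 7 \<le> \<tau> ^ 8"
proof -
  have "0.543 * 0.543 < \<rho> * \<rho>" using lower by (intro mult_strict_mono) auto
  then have "1.8378 \<le> \<tau>" using lower by (simp add: tau power2_eq_square)
  then have "1.8378 ^ 8 \<le> \<tau> ^ 8" by (intro power_mono) auto
  moreover have "(2::real) ^ 7 \<le> 1.8378 ^ 8" by (simp add: eval_nat_numeral)
  ultimately show ?thesis by linarith
qed

end

text \<open>Nonvanishing replaces any finer lower bound: the product of two nonzero integers is at least the
  larger of them in absolute value.\<close>

lemma trib_neg_pair_growth:
  assumes "4 \<le> n" "trib_neg n \<noteq> 0" "trib_neg (n + 1) \<noteq> 0"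
  shows "2 ^ (7 * n) \<le> 2 ^ 40 * (trib_neg n * trib_neg (n + 1)) ^ 16"
proof -
  obtain \<rho> :: real where \<rho>: "\<rho> ^ 3 + \<rho>\<^sup>2 + \<rho> = 1" "0.543 < \<rho>" "\<rho> < 0.544"
    by (rule small_root_exists)
  define \<tau> where "\<tau> = 1 + \<rho> + \<rho>\<^sup>2"
  define X where "X = \<bar>trib_neg n * trib_neg (n + 1)\<bar>"
  have one: "1 \<le> \<bar>trib_neg n\<bar>" "1 \<le> \<bar>trib_neg (n + 1)\<bar>" using assms by auto
  have "\<bar>trib_neg n\<bar> * 1 \<le> X" "1 * \<bar>trib_neg (n + 1)\<bar> \<le> X"
    unfolding X_def abs_mult using one by (intro mult_left_mono mult_right_mono; simp)+
  then have X: "\<bar>trib_neg n\<bar> \<le> X" "\<bar>trib_neg (n + 1)\<bar> \<le> X" "1 \<le> X" using one by auto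
  then have "\<tau> ^ n \<le> 32 * (real_of_int X)\<^sup>2"
    using assms(1) by (intro power_le_consecutive_trib_neg[OF \<rho> \<tau>_def]) linarith+
  moreover have "0 \<le> \<tau>" unfolding \<tau>_def using \<rho>(2) by simp
  ultimately have "(\<tau> ^ n) ^ 8 \<le> (32 * (real_of_int X)\<^sup>2) ^ 8" by (intro power_mono) auto
  also have "\<dots> = real_of_int (2 ^ 40 * X ^ 16)" by (simp add: power_mult_distrib flip: power_mult)
  also have "X ^ 16 = (trib_neg n * trib_neg (n + 1)) ^ 16"
    unfolding X_def by (simp add: power_even_abs)
  finally have "(\<tau> ^ n) ^ 8 \<le> real_of_int (2 ^ 40 * (trib_neg n * trib_neg (n + 1)) ^ 16)" .
  moreover have "(2 ^ 7) ^ n \<le> (\<tau> ^ 8) ^ n"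
    by (intro power_mono tau_power_8[OF \<rho> \<tau>_def]) auto
  moreover have "(\<tau> ^ 8) ^ n = (\<tau> ^ n) ^ 8" by (simp add: mult.commute flip: power_mult)
  moreover have "(2 ^ 7) ^ n = real_of_int (2 ^ (7 * n))" by (simp add: power_mult)
  ultimately show ?thesis by linarith
qed

text \<open>The window is cut into $p$ disjoint pairs of neighbours, with possibly some terms left over, whose
  absolute values are at least 1.\<close>

lemma trib_neg_prod_growth:
  assumes "4 \<le> n" "\<And>j. j \<in> {n..n + r} \<Longrightarrow> trib_neg j \<noteq> 0" "2 * p \<le> r + 1"
  shows "2 ^ (7 * p * (n + p)) \<le> 2 ^ (47 * p) * trib_neg_prod n (n + r) ^ 16"
proof -
  have *: "2 ^ (7 * q * (n + q)) \<le> 2 ^ (47 * q) * (\<Prod>j=n..<n + 2 * q. trib_neg j) ^ 16"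
    if "2 * q \<le> r + 1" for q
    using that
  proof (induction q)
    case (Suc q)
    have "(2::int) ^ (7 * Suc q * (n + Suc q)) = 2 ^ 7 * 2 ^ (7 * q * (n + q)) * 2 ^ (7 * (n + 2 * q))"
      unfolding power_add[symmetric] by (intro arg_cong[of _ _ "power 2"]) (simp add: algebra_simps)
    also have "\<dots> \<le> 2 ^ 7 * (2 ^ (47 * q) * (\<Prod>j=n..<n + 2 * q. trib_neg j) ^ 16) *
       (2 ^ 40 * (trib_neg (n + 2 * q) * trib_neg (n + 2 * q + 1)) ^ 16)"
      using assms Suc by (intro mult_mono mult_left_mono trib_neg_pair_growth) auto
    also have "\<dots> = 2 ^ (47 * Suc q) * (\<Prod>j=n..<n + 2 * Suc q. trib_neg j) ^ 16"
      by (simp add: power_mult_distrib power_add)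
    finally show ?case .
  qed simp
  define A B where "A = (\<Prod>j=n..<n + 2 * p. trib_neg j)" "B = (\<Prod>j=n + 2 * p..<n + r + 1. trib_neg j)"
  have "trib_neg_prod n (n + r) = (\<Prod>j=n..<n + r + 1. trib_neg j)"
    unfolding trib_neg_prod_def by (intro prod.cong) auto
  also have "\<dots> = A * B" unfolding A_B_def
    by (rule prod.atLeastLessThan_concat[symmetric]) (use assms(3) in auto)
  finally have AB: "trib_neg_prod n (n + r) = A * B" .
  have "B \<noteq> 0" unfolding A_B_def using assms(2) by auto
  then have "0 < B ^ 16" by (simp add: zero_less_power_eq)
  then have "1 \<le> B ^ 16" by linarith
  then have "A ^ 16 * 1 \<le> A ^ 16 * B ^ 16" by (intro mult_left_mono) auto
  then have "2 ^ (47 * p) * A ^ 16 \<le> 2 ^ (47 * p) * (A * B) ^ 16" by (simp add: power_mult_distrib)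
  moreover have "2 ^ (7 * p * (n + p)) \<le> 2 ^ (47 * p) * A ^ 16" using *[OF assms(3)] unfolding A_B_def .
  ultimately show ?thesis unfolding AB by linarith
qed

text \<open>For $k = 9$ the two sides are 972 and 1024.\<close>

lemma power_2_ge_quadratic: "9 \<le> k \<Longrightarrow> 2 * (k * k) + 90 * k \<le> (2::nat) ^ (k + 1)"
  by (induction k rule: dec_induct) auto

text \<open>With $|P| \le 47^V$ both exponents are linear in $p$, so $p$ cancels and $n$ is bounded by a constant
  plus a multiple of $k$, which is logarithmic in $n$. The comparison of 47 with a power of 2 uses
  $47^9 < 2^{50}$, and 425 is close to the smallest $n$ for which the argument works.\<close>

lemma no_small_base_bound:
  fixes n p k V :: nat and P :: int
  assumes growth: "2 ^ (7 * p * (n + p)) \<le> 2 ^ (47 * p) * P ^ 16"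
    and "0 \<le> P" "P \<le> 47 ^ V" "V \<le> 3 * p + 2 + 4 * k" "1 \<le> p" "2 ^ (k + 1) < n" "425 \<le> n"
  shows False
proof -
  have "1 * (4 * k) \<le> p * (4 * k)" using assms(5) by (rule mult_right_mono) simp
  then have V: "V \<le> p * (4 * k + 5)" using assms(4,5) unfolding distrib_left by linarith
  have "2 ^ (63 * p * (n + p)) = ((2::int) ^ (7 * p * (n + p))) ^ 9" by (simp add: mult_ac flip: power_mult)
  also have "\<dots> \<le> (2 ^ (47 * p) * P ^ 16) ^ 9" using growth by (intro power_mono) auto
  also have "\<dots> = 2 ^ (423 * p) * P ^ 144" by (simp add: power_mult_distrib mult_ac flip: power_mult)
  also have "\<dots> \<le> 2 ^ (423 * p) * 2 ^ (800 * V)"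
  proof -
    have "P ^ 144 \<le> (47 ^ V) ^ 144" using assms by (intro power_mono) auto
    also have "(47 ^ V) ^ 144 = ((47::int) ^ 9) ^ (16 * V)"
      unfolding power_mult[symmetric] by (rule arg_cong[of _ _ "power 47"]) simp
    also have "\<dots> \<le> (2 ^ 50) ^ (16 * V)" by (intro power_mono) auto
    also have "\<dots> = 2 ^ (800 * V)"
      unfolding power_mult[symmetric] by (rule arg_cong[of _ _ "power 2"]) simp
    finally show ?thesis by simp
  qed
  also have "\<dots> = 2 ^ (423 * p + 800 * V)" by (simp add: power_add)
  finally have "(2::int) ^ (63 * p * (n + p)) \<le> 2 ^ (423 * p + 800 * V)" .
  then have "63 * p * (n + p) \<le> 423 * p + 800 * V"
    by (subst (asm) power_increasing_iff) simp_all
  also have "\<dots> \<le> 423 * p + 800 * (p * (4 * k + 5))" using V by simp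
  finally have "p * (63 * (n + p)) \<le> p * (423 + 800 * (4 * k + 5))" by (simp add: algebra_simps)
  then have "63 * (n + p) \<le> 423 + 800 * (4 * k + 5)" using assms(5) by simp
  then have *: "63 * n + 63 \<le> 4423 + 3200 * k" using assms(5) by simp
  consider "k \<le> 7" | "k = 8" | "9 \<le> k" by linarith
  then show False
  proof cases
    case 3
    have "9 * k \<le> k * k" using 3 by simp
    then show False using power_2_ge_quadratic[OF 3] assms(6) * 3 by linarith
  qed (use * assms in auto)
qed

text \<open>The line meets the graph at 128 and is steeper than the tangent there, because $\ln 2 \ge 1/2$.\<close>

lemma log_2_le:
  assumes "128 \<le> (x::real)"
  shows "log 2 x \<le> 5 + x / 64"
proof -
  have "1 / 2 \<le> ln (2::real)" using ln_le_minus_one[of "1 / 2 :: real"] by (simp add: ln_div)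
  then have slope: "1 * (x / 128 - 1) \<le> (2 * ln 2) * (x / 128 - 1)"
    using assms by (intro mult_right_mono) auto
  have "ln x = ln (2 ^ 7) + ln (x / 128)" using assms by (simp add: ln_div)
  also have "ln (2 ^ 7) = 7 * ln (2::real)" by (subst ln_realpow) auto
  also have "ln (x / 128) \<le> 1 * (x / 128 - 1)" using assms ln_le_minus_one[of "x / 128"] by simp
  also note slope
  finally have "ln x \<le> 7 * ln 2 + (2 * ln 2) * (x / 128 - 1)" by simp
  also have "\<dots> = ln 2 * (5 + x / 64)" by (simp add: algebra_simps)
  finally show ?thesis by (simp add: log_def field_simps)
qed

text \<open>Taking logarithms in $|P| \le (2V+4)^V$, and replacing the logarithm by a linear function,
  turns the growth estimate into a polynomial inequality between $n$, $p$ and $k$.\<close>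

lemma growth_quadratic:
  fixes n p k V :: nat and P :: int
  assumes growth: "2 ^ (7 * p * (n + p)) \<le> 2 ^ (47 * p) * P ^ 16"
    and "0 < P" "P \<le> (2 * int V + 4) ^ V" "V \<le> 3 * p + 2 + 4 * k" "62 \<le> V"
  shows "5 * (int p * int p) + 14 * (int p * int n) \<le>
     int p * (592 + 24 * int k) + 328 + 664 * int k + 16 * (int k * int k)"
proof -
  define W where "W = 3 * real p + 2 + 4 * real k"
  have V: "62 \<le> real V" "real V \<le> W" unfolding W_def using assms(4,5) by linarith+
  have "real_of_int (2 ^ (7 * p * (n + p))) \<le> real_of_int (2 ^ (47 * p) * P ^ 16)"
    using growth by (simp only: of_int_le_iff)
  then have "(2::real) ^ (7 * p * (n + p)) \<le> 2 ^ (47 * p) * real_of_int P ^ 16" by simp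
  then have "log 2 (2 ^ (7 * p * (n + p))) \<le> log 2 (2 ^ (47 * p) * real_of_int P ^ 16)"
    using assms(2) by (subst log_le_cancel_iff) auto
  also have "\<dots> = 47 * p + 16 * log 2 (real_of_int P)"
    using assms(2) by (simp add: log_mult log_nat_power)
  also have "log 2 (2 ^ (7 * p * (n + p))) = real (7 * p * (n + p))"
    by (subst log_nat_power) auto
  finally have "real (7 * p * (n + p)) \<le> 47 * p + 16 * log 2 (real_of_int P)" .
  moreover have "log 2 (real_of_int P) \<le> V * log 2 (2 * real V + 4)"
  proof -
    have "real_of_int P \<le> real_of_int ((2 * int V + 4) ^ V)"
      using assms(3) by (simp only: of_int_le_iff)
    then have "real_of_int P \<le> (2 * real V + 4) ^ V" by simp
    then have "log 2 (real_of_int P) \<le> log 2 ((2 * real V + 4) ^ V)"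
      using assms(2) by (subst log_le_cancel_iff) auto
    then show ?thesis by (simp add: log_nat_power)
  qed
  moreover have "V * log 2 (2 * real V + 4) \<le> V * (5 + (2 * real V + 4) / 64)"
    using V by (intro mult_left_mono log_2_le) auto
  moreover have "V * (5 + (2 * real V + 4) / 64) \<le> W * (5 + (2 * W + 4) / 64)"
    using V by (intro mult_mono add_mono divide_right_mono) auto
  ultimately have "real (7 * p * (n + p)) \<le> 47 * p + 16 * (W * (5 + (2 * W + 4) / 64))" by linarith
  then have "real_of_int (5 * (int p * int p) + 14 * (int p * int n)) \<le>
     real_of_int (int p * (592 + 24 * int k) + 328 + 664 * int k + 16 * (int k * int k))"
    unfolding W_def by (simp add: field_simps)
  then show ?thesis by (simp only: of_int_le_iff)
qed

text \<open>Once $V$ must be large, either $p$ is large, and then the quadratic terms in $p$ decide, or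
  $k$ is large, and then $n > 2^{k+1}$ does. For $k \le 8$ the lower bound on
  $3p + 2 + 4k$ turns into a lower bound on $p$, and finitely many linear comparisons remain.\<close>

lemma growth_quadratic_fails:
  fixes n p k :: nat
  assumes "2 ^ (k + 1) < n" "1 \<le> p"
    and "(58 \<le> n \<and> 96 \<le> 3 * p + 2 + 4 * k) \<or> (18 \<le> n \<and> 490 \<le> 3 * p + 2 + 4 * k)"
  shows "int p * (592 + 24 * int k) + 328 + 664 * int k + 16 * (int k * int k)
    < 5 * (int p * int p) + 14 * (int p * int n)"
proof -
  define B where "B = 14 * int n + 5 * int p - 592 - 24 * int k"
  \<comment> \<open>It suffices to have lower bounds $p_0$ for $p$ and $B_0$ for $B$ whose product exceeds the terms free of $p$.\<close>
  have main: ?thesis if "328 + 664 * int k + 16 * (int k * int k) < p0 * B0"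
    "0 \<le> p0" "0 \<le> B0" "p0 \<le> int p" "B0 \<le> B" for p0 B0
  proof -
    have "p0 * B0 \<le> int p * B" using that by (intro mult_mono) auto
    then show ?thesis using that(1) unfolding B_def by (simp add: algebra_simps)
  qed
  show ?thesis
  proof (cases "9 \<le> k")
    case True
    have "2 * (k * k) + 90 * k < n" using power_2_ge_quadratic[OF True] assms(1) by linarith
    then have "int (2 * (k * k) + 90 * k) \<le> int n" by (simp only: of_nat_le_iff)
    then have n: "2 * (int k * int k) + 90 * int k \<le> int n" by simp
    show ?thesis
    proof (rule main[of 1 "1236 * int k + 28 * (int k * int k) - 592"])
      show "1236 * int k + 28 * (int k * int k) - 592 \<le> B" unfolding B_def using n by linarith
      have sq: "328 + 664 * K + 16 * (K * K) < 1236 * K + 28 * (K * K) - 592"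
        "0 \<le> 1236 * K + 28 * (K * K) - 592" if "9 \<le> K" for K :: int
      proof -
        have "0 \<le> K * K" by simp
        then show "0 \<le> 1236 * K + 28 * (K * K) - 592" using that by linarith
        show "328 + 664 * K + 16 * (K * K) < 1236 * K + 28 * (K * K) - 592"
          using that \<open>0 \<le> K * K\<close> by linarith
      qed
      show "328 + 664 * int k + 16 * (int k * int k) < 1 * (1236 * int k + 28 * (int k * int k) - 592)"
        using sq(1)[of "int k"] True by simp
      show "0 \<le> 1236 * int k + 28 * (int k * int k) - 592"
        using sq(2)[of "int k"] True by simp
    qed (use assms(2) in auto)
  next
    case False
    then have k: "k = 0 \<or> k = 1 \<or> k = 2 \<or> k = 3 \<or> k = 4 \<or> k = 5 \<or> k = 6 \<or> k = 7 \<or> k = 8" by auto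
    from assms(3) show ?thesis
    proof
      assume "18 \<le> n \<and> 490 \<le> 3 * p + 2 + 4 * k"
      then show ?thesis using k by (intro main[of 152 228]) (auto simp: B_def)
    next
      assume c: "58 \<le> n \<and> 96 \<le> 3 * p + 2 + 4 * k"
      show ?thesis
      proof (cases "k \<le> 5")
        case True
        then show ?thesis using k c assms(1) by (intro main[of 25 254]) (auto simp: B_def)
      next
        case False
        then show ?thesis using k c assms(1) by (intro main[of 21 1000]) (auto simp: B_def)
      qed
    qed
  qed
qed

section \<open>Products of factorials, and windows of small index\<close>

definition fact_prod :: "nat multiset \<Rightarrow> nat" where
  "fact_prod A = (\<Prod>m\<in>#A. fact m)"

lemma fact_prod_simps [simp]:
  "fact_prod {#} = 1" "fact_prod (add_mset m A) = fact m * fact_prod A"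
  by (simp_all add: fact_prod_def)

lemma fact_prod_pos [simp]: "0 < fact_prod A"
  by (induction A) auto

lemma fact_dvd_fact_prod: "m \<in># A \<Longrightarrow> fact m dvd fact_prod A"
  by (metis dvd_triv_left fact_prod_simps(2) multi_member_split)

lemma prime_dvd_fact_prod_iff:
  assumes "prime q"
  shows "q dvd fact_prod A \<longleftrightarrow> (\<exists>m\<in>#A. q \<le> m)"
  using assms by (induction A) (auto simp: prime_dvd_mult_iff prime_dvd_fact_iff)

lemma fact_prod_le_power_multiplicity:
  assumes "\<And>m. m \<in># A \<Longrightarrow> fact m \<le> c ^ multiplicity 2 (fact m :: nat)"
  shows "fact_prod A \<le> c ^ multiplicity 2 (fact_prod A)"
  using assms
proof (induction A)
  case (add m A)
  have "fact m * fact_prod A \<le> c ^ multiplicity 2 (fact m :: nat) * c ^ multiplicity 2 (fact_prod A)"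
    using add by (intro mult_mono) auto
  then show ?case by (simp add: multiplicity_2_mult_nat power_add)
qed simp

lemma multiplicity_2_fact_le_fact_prod:
  "m \<in># A \<Longrightarrow> multiplicity 2 (fact m :: nat) \<le> multiplicity 2 (fact_prod A)"
  using fact_prod_pos[of A] by (intro dvd_imp_multiplicity_le fact_dvd_fact_prod) auto

lemma multiplicity_2_ge_of_prime_dvd:
  assumes "prime q" "q dvd fact_prod A" "q < 2 ^ e"
  shows "q \<le> multiplicity 2 (fact_prod A) + e"
proof -
  obtain m where m: "m \<in># A" "q \<le> m" using assms prime_dvd_fact_prod_iff by blast
  have "multiplicity 2 (fact q :: nat) \<le> multiplicity 2 (fact m :: nat)"
    using m by (intro dvd_imp_multiplicity_le fact_dvd) auto
  also have "\<dots> \<le> multiplicity 2 (fact_prod A)" using m by (intro multiplicity_2_fact_le_fact_prod)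
  finally show ?thesis using multiplicity_2_fact_ge[OF assms(3)] by linarith
qed

lemma fact_prod_le_47_power:
  assumes "\<not> 103 dvd fact_prod A"
  shows "fact_prod A \<le> 47 ^ multiplicity 2 (fact_prod A)"
proof (intro fact_prod_le_power_multiplicity fact_le_47_power)
  fix m assume "m \<in># A"
  have "prime (103::nat)" by simp
  then show "m \<le> 102" using assms \<open>m \<in># A\<close> prime_dvd_fact_prod_iff[of 103 A] by force
qed

text \<open>For numbers up to 102 the base 47 suffices, and $47 \le 2V + 4$; beyond, the base
  $m + 1$ suffices, and $m + 1 \le 2V$.\<close>

lemma fact_prod_le_power:
  assumes "22 \<le> multiplicity 2 (fact_prod A)"
  shows "fact_prod A \<le> (2 * multiplicity 2 (fact_prod A) + 4) ^ multiplicity 2 (fact_prod A)"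
proof (rule fact_prod_le_power_multiplicity)
  fix m assume m: "m \<in># A"
  show "fact m \<le> (2 * multiplicity 2 (fact_prod A) + 4) ^ multiplicity 2 (fact m :: nat)"
  proof (cases "m \<le> 102")
    case True
    have "fact m \<le> (47::nat) ^ multiplicity 2 (fact m :: nat)" by (rule fact_le_47_power[OF True])
    also have "\<dots> \<le> (2 * multiplicity 2 (fact_prod A) + 4) ^ multiplicity 2 (fact m :: nat)"
      using assms by (intro power_mono) auto
    finally show ?thesis .
  next
    case False
    have "fact m \<le> (m + 1) ^ multiplicity 2 (fact m :: nat)"
      using False by (intro fact_le_power_multiplicity_2) auto
    also have "\<dots> \<le> (2 * multiplicity 2 (fact_prod A) + 4) ^ multiplicity 2 (fact m :: nat)"
      using fact_le_power_multiplicity_2(2)[of m] multiplicity_2_fact_le_fact_prod[OF m] False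
      by (intro power_mono) auto
    finally show ?thesis .
  qed
qed

text \<open>The smallest odd prime above $m$ for $m < 13$; beyond that range, 13 is a default.\<close>

definition prime_above :: "nat \<Rightarrow> nat" where
  "prime_above m = (if m < 3 then 3 else if m < 5 then 5 else if m < 7 then 7 else if m < 11 then 11 else 13)"

lemma prime_above: "m < 13 \<Longrightarrow> prime (prime_above m) \<and> m < prime_above m"
  by (simp add: prime_above_def)

text \<open>Decides whether $x$ is a product of factorials of numbers at most $m$, by removing the largest
  factorial as long as possible and backtracking. Divisibility by a prime above $m$ prunes the search.
  Nested conditionals instead of connectives make rewriting evaluate the second branch only
  if the first fails.\<close>

function splits :: "nat \<Rightarrow> nat \<Rightarrow> bool" where
  "splits m x = (if m < 2 then x = 1
     else if prime_above m dvd x then False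
     else if 0 < x \<and> fact m dvd x
       then if splits m (x div fact m) then True else splits (m - 1) x
     else splits (m - 1) x)"
  by pat_completeness auto
termination
proof (relation "measure (\<lambda>(m, x). m + x)", safe)
  fix m x :: nat
  assume "\<not> m < 2" "0 < x"
  then have "1 < (fact m :: nat)" using fact_mono[of 2 m, where ?'a = nat] by simp
  then show "((m, x div fact m), m, x) \<in> measure (\<lambda>(m, x). m + x)"
    using \<open>0 < x\<close> by (simp add: div_less_dividend)
qed auto

declare splits.simps [simp del]

text \<open>The search is complete: if $m$ occurs, removing $m!$ leaves a smaller product of the same kind;
  otherwise all numbers are at most $m - 1$. The prime used for pruning divides no such product.\<close>

lemma splits_fact_prod:
  assumes "\<And>i. i \<in># A \<Longrightarrow> i \<le> m" "m < 13"
  shows "splits m (fact_prod A)"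
  using assms
proof (induction m "fact_prod A" arbitrary: A rule: splits.induct)
  case (1 m A)
  note bound = "1.prems"(1)
  have q: "\<not> prime_above m dvd fact_prod A"
    using prime_above[OF "1.prems"(2)] bound by (meson leD order_trans prime_dvd_fact_prod_iff)
  show ?case
  proof (cases "m < 2")
    case True
    then have "\<forall>i\<in>#A. i < 2" using bound by force
    then have "fact_prod A = 1" by (induction A) (auto simp: less_2_cases_iff)
    then show ?thesis using True by (subst splits.simps) simp
  next
    case False
    show ?thesis
    proof (cases "m \<in># A")
      case True
      then obtain B where B: "A = add_mset m B" by (metis multi_member_split)
      then have AB: "fact_prod A = fact m * fact_prod B" by simp
      then have div: "fact_prod A div fact m = fact_prod B" by simp
      moreover have "splits m (fact_prod B)"
        using "1.prems" B AB False q div by (intro "1.hyps"(1)) auto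
      ultimately show ?thesis using AB False q by (subst splits.simps) simp
    next
      case no: False
      then have le: "i \<le> m - 1" if "i \<in># A" for i
        using bound[OF that] that by (cases "i = m") auto
      have "splits (m - 1) (fact_prod A)" if "0 < fact_prod A \<and> fact m dvd fact_prod A"
        "\<not> splits m (fact_prod A div fact m)"
        using that "1.prems"(2) le False q by (intro "1.hyps"(2)) auto
      moreover have "splits (m - 1) (fact_prod A)" if "\<not> (0 < fact_prod A \<and> fact m dvd fact_prod A)"
        using that "1.prems"(2) le False q by (intro "1.hyps"(3)) auto
      ultimately show ?thesis using False q by (subst splits.simps) auto
    qed
  qed
qed

text \<open>A number that is not divisible by 103 and exceeds the bound $47^V$ is no product of factorials. The
  few other windows without solutions lack one of the primes 5, 11, 13, so that only factorials of smaller numbers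
  can occur, and a search settles them.\<close>

definition excluded :: "nat \<Rightarrow> bool" where
  "excluded x = (if val_pow 47 x < x then True
     else if \<not> 5 dvd x then \<not> splits 4 x
     else if \<not> 11 dvd x then \<not> splits 10 x
     else if \<not> 13 dvd x then \<not> splits 12 x
     else False)"

lemma not_excluded_fact_prod:
  assumes "\<not> 103 dvd fact_prod A"
  shows "\<not> excluded (fact_prod A)"
proof -
  have splits: "splits m (fact_prod A)"
    if "\<not> q dvd fact_prod A" "prime q" "q = m + 1" "m < 13" for m q
  proof (rule splits_fact_prod[OF _ \<open>m < 13\<close>])
    fix i assume "i \<in># A"
    then show "i \<le> m" using that prime_dvd_fact_prod_iff[of q A] by force
  qed
  have "\<not> 5 dvd fact_prod A \<Longrightarrow> splits 4 (fact_prod A)" by (rule splits[of 5]) simp_all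
  moreover have "\<not> 11 dvd fact_prod A \<Longrightarrow> splits 10 (fact_prod A)" by (rule splits[of 11]) simp_all
  moreover have "\<not> 13 dvd fact_prod A \<Longrightarrow> splits 12 (fact_prod A)" by (rule splits[of 13]) simp_all
  moreover have "\<not> val_pow 47 (fact_prod A) < fact_prod A"
    using fact_prod_le_47_power[OF assms] by (simp add: val_pow_eq)
  ultimately show ?thesis unfolding excluded_def by presburger
qed

lemma trib_list_numeral [simp]:
  "trib_list (numeral k) a b c = a # trib_list (pred_numeral k) b c (a - b - c)"
  by (simp add: numeral_eq_Suc)

text \<open>The terms of all windows below 86, and the three terms from which the later ones are generated.\<close>

lemma trib_neg_list:
  "map trib_neg [5..<89] = [2, -3, 1, 4, -8, 5, 7, -20, 18, 9, -47, 56, 0, -103, 159, -56, -206, 421, -271, -356, 1048,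
    -963, -441, 2452, -2974, 81, 5345, -8400, 3136, 10609, -22145, 14672, 18082, -54899, 51489,
    21492, -127880, 157877, -8505, -277252, 443634, -174887, -545999, 1164520, -793408, -917111,
    2875039, -2751336, -1040814, 6667189, -8377711, 669708, 14375192, -23422611, 9717127,
    28080676, -61220414, 42856865, 46444225, -150521504, 146934144, 50031585, -347487233,
    444389792, -46870974, -745006051, 1236266817, -538131740, -1443141128, 3217539685,
    -2312530297, -2348150516, 7878220498, -7842600279, -2383770735, 18104591512, -23563421056,
    3075058809, 38592953759, -65231433624, 29713538674, 74110848709, -169055821007,
    124658510972]"
proof -
  have "trib_neg (5 + 1) = -3" "trib_neg (5 + 2) = 1" by (simp_all add: trib_neg_values)
  then have "map trib_neg [5..<5 + 84] = trib_list 84 2 (-3) 1"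
    using trib_list_eq[of 84 5] unfolding trib_neg_values(4) by simp
  then show ?thesis by simp
qed

definition solution_pairs :: "(nat \<times> nat) set" where
  "solution_pairs = {(5,1), (5,2), (5,3), (5,4), (5,5), (5,8), (5,9), (6,2), (6,3), (6,4), (6,7),
          (7,1), (7,2), (8,1), (7,7), (8,6)}"

text \<open>Extends a window that starts at index $n$ with product $x$ to the right by the terms in the
  list, until a multiple of 103 occurs. The value $r = 0$ stands for a single term, which is no admissible
  window. Since $T_{-17} = 0$ is a multiple of 103, windows across this zero are never formed.\<close>

fun check_from :: "nat \<Rightarrow> nat \<Rightarrow> nat \<Rightarrow> nat list \<Rightarrow> bool" where
  "check_from n r x ys \<longleftrightarrow> (if r = 0 \<or> (n, r) \<in> solution_pairs then True else excluded x) \<and>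
     (case ys of [] \<Rightarrow> True
      | y # ys \<Rightarrow> if 103 dvd y then True else check_from n (r + 1) (x * y) ys)"

declare check_from.simps [simp del]

fun check_all :: "nat \<Rightarrow> nat list \<Rightarrow> bool" where
  "check_all n [] = True"
| "check_all n (x # xs) = ((if 103 dvd x then True else check_from n 0 x xs) \<and> check_all (n + 1) xs)"

lemma check_fromD:
  assumes "check_from n r x ys" "i \<le> length ys" "\<And>j. j < i \<Longrightarrow> \<not> 103 dvd ys ! j" "0 < r + i"
  shows "(n, r + i) \<in> solution_pairs \<or> excluded (x * (\<Prod>j<i. ys ! j))"
  using assms
proof (induction i arbitrary: r x ys)
  case 0
  then show ?case by (subst (asm) check_from.simps) (auto split: if_splits)
next
  case (Suc i)
  then obtain y zs where ys: "ys = y # zs" by (cases ys) auto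
  have "check_from n (r + 1) (x * y) zs"
    using Suc.prems(1) Suc.prems(3)[of 0] unfolding ys
    by (subst (asm) check_from.simps) (auto split: if_splits)
  then have "(n, (r + 1) + i) \<in> solution_pairs \<or> excluded (x * y * (\<Prod>j<i. zs ! j))"
    using Suc.prems(3)[of "Suc j" for j] Suc.prems(2) unfolding ys by (intro Suc.IH) auto
  then show ?case by (simp add: ys prod.lessThan_Suc_shift mult.assoc del: prod.lessThan_Suc)
qed

lemma check_allD:
  assumes "check_all n xs" "i < length xs" "\<not> 103 dvd xs ! i"
  shows "check_from (n + i) 0 (xs ! i) (drop (Suc i) xs)"
  using assms
proof (induction i arbitrary: n xs)
  case 0
  then show ?case by (cases xs) (auto split: if_splits)
next
  case (Suc i)
  then obtain y zs where "xs = y # zs" by (cases xs) auto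
  then show ?case using Suc.IH[of "n + 1" zs] Suc.prems by simp
qed

text \<open>Tests whether each of $k$ consecutive terms exceeds 47 to the power of its own valuation.\<close>

fun heavy_run :: "nat \<Rightarrow> int \<Rightarrow> int \<Rightarrow> int \<Rightarrow> bool" where
  "heavy_run 0 a b c = True"
| "heavy_run (Suc k) a b c = (val_pow 47 (nat \<bar>a\<bar>) < nat \<bar>a\<bar> \<and> heavy_run k b c (a - b - c))"

lemma heavy_run_numeral [simp]:
  "heavy_run (numeral k) a b c =
     (val_pow 47 (nat \<bar>a\<bar>) < nat \<bar>a\<bar> \<and> heavy_run (pred_numeral k) b c (a - b - c))"
  by (simp add: numeral_eq_Suc)

lemma heavy_runD:
  assumes "heavy_run k (trib_neg i) (trib_neg (i + 1)) (trib_neg (i + 2))" "i \<le> j" "j < i + k"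
  shows "val_pow 47 (nat \<bar>trib_neg j\<bar>) < nat \<bar>trib_neg j\<bar>"
  using assms
proof (induction k arbitrary: i)
  case (Suc k)
  have "trib_neg (i + 1 + 2) = trib_neg i - trib_neg (i + 1) - trib_neg (i + 2)"
    using trib_neg_rec[of i] by (simp only: add.assoc) simp
  moreover have "i + 1 + 1 = i + 2" by simp
  ultimately have "heavy_run k (trib_neg (i + 1)) (trib_neg (i + 1 + 1)) (trib_neg (i + 1 + 2))"
    and now: "val_pow 47 (nat \<bar>trib_neg i\<bar>) < nat \<bar>trib_neg i\<bar>"
    using Suc.prems(1) by (simp_all only: heavy_run.simps)
  then have later: "val_pow 47 (nat \<bar>trib_neg j\<bar>) < nat \<bar>trib_neg j\<bar>" if "i + 1 \<le> j"
    using that Suc.prems(3) by (intro Suc.IH) auto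
  show ?case
  proof (cases "j = i")
    case False
    then show ?thesis using later Suc.prems(2) by simp
  qed (use now in simp)
qed simp

lemma trib_neg_nth: "i < 84 \<Longrightarrow> trib_neg (5 + i) = map trib_neg [5..<89] ! i"
  by (subst nth_map_upt) auto

text \<open>From index 86 on every single term beats the bound, so every window does, and no
  products have to be computed. The last earlier failure is at index 81.\<close>

lemma trib_neg_heavy:
  assumes "86 \<le> j" "j < 425"
  shows "val_pow 47 (nat \<bar>trib_neg j\<bar>) < nat \<bar>trib_neg j\<bar>"
proof (rule heavy_runD)
  have "trib_neg 86 = map trib_neg [5..<89] ! 81" "trib_neg (86 + 1) = map trib_neg [5..<89] ! 82"
    "trib_neg (86 + 2) = map trib_neg [5..<89] ! 83"
    using trib_neg_nth[of 81] trib_neg_nth[of 82] trib_neg_nth[of 83] by simp_all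
  moreover have "heavy_run 339 (map trib_neg [5..<89] ! 81) (map trib_neg [5..<89] ! 82)
    (map trib_neg [5..<89] ! 83)"
    unfolding trib_neg_list by (simp add: val_pow.simps)
  ultimately show "heavy_run 339 (trib_neg 86) (trib_neg (86 + 1)) (trib_neg (86 + 2))"
    by (simp only:)
qed (use assms in auto)

text \<open>Since 103 divides $T_{-85}$, a window that starts before 86 and avoids 103 also ends before 86.\<close>

lemma check_all_trib_neg: "check_all 5 (map (\<lambda>j. nat \<bar>trib_neg j\<bar>) [5..<86])"
proof -
  have "[5..<86] = take 81 [5..<89]" by simp
  then have "map (\<lambda>j. nat \<bar>trib_neg j\<bar>) [5..<86] = map (\<lambda>t. nat \<bar>t\<bar>) (take 81 (map trib_neg [5..<89]))"
    by (simp add: take_map)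
  then show ?thesis
    unfolding trib_neg_list
    by (simp add: check_from.simps excluded_def splits.simps prime_above_def fact_numeral val_pow.simps solution_pairs_def)
qed

section \<open>The factorial equation\<close>

lemma abs_trib_neg_prod:
  "nat \<bar>trib_neg_prod n (n + r)\<bar> = nat \<bar>trib_neg n\<bar> * (\<Prod>j<r. nat \<bar>trib_neg (n + 1 + j)\<bar>)"
  by (induction r) (simp_all add: trib_neg_prod_def abs_mult nat_mult_distrib mult.assoc)

lemma finite_check:
  assumes "5 \<le> n" "0 < r" "n + r < 86" "\<And>j. j \<in> {n..n + r} \<Longrightarrow> \<not> 103 dvd trib_neg j"
  shows "(n, r) \<in> solution_pairs \<or> excluded (nat \<bar>trib_neg_prod n (n + r)\<bar>)"
proof -
  define y where "y j = nat \<bar>trib_neg j\<bar>" for j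
  define xs where "xs = map y [5..<86]"
  have y: "\<not> 103 dvd y j" if "j \<in> {n..n + r}" for j
  proof
    assume "103 dvd y j"
    then have "int 103 dvd int (y j)" by (simp only: of_nat_dvd_iff)
    then show False using assms(4)[OF that] by (simp add: y_def)
  qed
  have nth: "xs ! i = y (5 + i)" if "i < 81" for i
    unfolding xs_def using that by (subst nth_map_upt) auto
  have len: "length xs = 81" unfolding xs_def length_map length_upt by simp
  have all: "check_all 5 xs" unfolding xs_def y_def by (rule check_all_trib_neg)
  have drop: "drop (Suc (n - 5)) xs ! j = y (n + 1 + j)" if "j < r" for j
  proof -
    have "drop (Suc (n - 5)) xs ! j = xs ! (Suc (n - 5) + j)"
      using assms len that by (intro nth_drop) auto
    also have "\<dots> = y (5 + (Suc (n - 5) + j))" using assms that by (intro nth) auto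
    also have "5 + (Suc (n - 5) + j) = n + 1 + j" using assms by simp
    finally show ?thesis .
  qed
  have first: "xs ! (n - 5) = y n" using nth[of "n - 5"] assms by simp
  have "check_from (5 + (n - 5)) 0 (xs ! (n - 5)) (drop (Suc (n - 5)) xs)"
    by (rule check_allD[OF all]) (use assms y[of n] first len in auto)
  then have "check_from n 0 (y n) (drop (Suc (n - 5)) xs)"
    using assms(1) unfolding first by simp
  then have "(n, 0 + r) \<in> solution_pairs \<or> excluded (y n * (\<Prod>j<r. drop (Suc (n - 5)) xs ! j))"
    by (rule check_fromD) (use assms len y drop in auto)
  also have "(\<Prod>j<r. drop (Suc (n - 5)) xs ! j) = (\<Prod>j<r. y (n + 1 + j))"
    by (rule prod.cong) (use drop in auto)
  also have "y n * \<dots> = nat \<bar>trib_neg_prod n (n + r)\<bar>"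
    unfolding abs_trib_neg_prod y_def ..
  finally show ?thesis by simp
qed

lemma multiplicity_2_abs: "multiplicity 2 (nat \<bar>t\<bar>) = multiplicity 2 (t :: int)"
proof -
  have "multiplicity 2 \<bar>t\<bar> = multiplicity 2 t"
    using multiplicity_normalize_right[of 2 t] by (simp only: normalize_int_def)
  then show ?thesis using multiplicity_2_int[of "nat \<bar>t\<bar>"] by simp
qed

lemma multiplicity_2_trib_neg_prod:
  assumes "\<And>j. j \<in> {n..N} \<Longrightarrow> trib_neg j \<noteq> 0"
  shows "multiplicity 2 (trib_neg_prod n N) = (\<Sum>j=n..N. multiplicity 2 (trib_neg j))"
  unfolding trib_neg_prod_def using assms
  by (intro prime_elem_multiplicity_prod_distrib) auto

lemma prod_heavy:
  assumes "86 \<le> n" "n + r < 425"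
  shows "val_pow 47 (nat \<bar>trib_neg_prod n (n + r)\<bar>) < nat \<bar>trib_neg_prod n (n + r)\<bar>"
  using assms
proof (induction r)
  case 0
  then show ?case using trib_neg_heavy[of n] by (simp add: trib_neg_prod_def)
next
  case (Suc r)
  define x y where "x = nat \<bar>trib_neg_prod n (n + r)\<bar>" "y = nat \<bar>trib_neg (n + Suc r)\<bar>"
  have xy: "val_pow 47 x < x" "val_pow 47 y < y"
    unfolding x_y_def using Suc trib_neg_heavy[of "n + Suc r"] by auto
  have "nat \<bar>trib_neg_prod n (n + Suc r)\<bar> = x * y"
    unfolding x_y_def by (simp add: trib_neg_prod_def abs_mult nat_mult_distrib)
  moreover have "val_pow 47 (x * y) = val_pow 47 x * val_pow 47 y"
    using xy by (simp add: val_pow_eq multiplicity_2_mult_nat power_add)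
  moreover have "val_pow 47 x * val_pow 47 y < x * y"
    using xy by (intro mult_strict_mono) auto
  ultimately show ?case by simp
qed

text \<open>Modulo 103 a shift by 17 multiplies the sequence by 56, since $T_{-17}$, $T_{-18}$, $T_{-19}$ are congruent
  to $56 T_0$, $56 T_{-1}$, $56 T_{-2}$.\<close>

lemma dvd_103_trib_neg: "103 dvd trib_neg (17 * i)"
proof -
  have step: "103 dvd trib_neg (n + 17) - 56 * trib_neg n" for n
  proof (induction n rule: less_induct)
    case (less n)
    consider "n = 0" | "n = 1" | "n = 2" | "3 \<le> n" by linarith
    then show ?case
    proof cases
      case 4
      define m where "m = n - 3"
      have n: "n = m + 3" "n + 17 = (m + 17) + 3" using 4 by (simp_all add: m_def)
      have "trib_neg (n + 17) - 56 * trib_neg n =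
         (trib_neg (m + 17) - 56 * trib_neg m) - (trib_neg ((m + 1) + 17) - 56 * trib_neg (m + 1))
         - (trib_neg ((m + 2) + 17) - 56 * trib_neg (m + 2))"
        unfolding n(2) unfolding n(1) trib_neg_rec by (simp add: algebra_simps)
      then show ?thesis using less.IH[of m] less.IH[of "m + 1"] less.IH[of "m + 2"] n(1)
        by (simp only: dvd_diff less_add_same_cancel1)
    qed (simp_all add: trib_neg_values)
  qed
  show ?thesis
  proof (induction i)
    case (Suc i)
    have "103 dvd (trib_neg (17 * i + 17) - 56 * trib_neg (17 * i)) + 56 * trib_neg (17 * i)"
      using Suc step[of "17 * i"] by (intro dvd_add) auto
    then show ?case by (simp add: algebra_simps)
  qed simp
qed

text \<open>If 103 does not divide the product, the window avoids all multiples of 17, among them 85 and 425, at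
  which the two finite ranges end. If 103 divides the product, then
  $V \ge 96$, and the growth estimate exceeds the bound $(2V+4)^V$.\<close>

lemma factorial_equation_solutions:
  assumes n: "5 \<le> n" and r: "0 < r" and eq: "\<bar>trib_neg_prod n (n + r)\<bar> = int (fact_prod A)"
  shows "(n, r) \<in> solution_pairs"
proof -
  define x where "x = fact_prod A"
  define V where "V = multiplicity 2 x"
  define p where "p = (r + 1) div 2"
  define k where "k = (LEAST k. n \<le> 4 * 2 ^ k)"
  have x: "nat \<bar>trib_neg_prod n (n + r)\<bar> = x" "0 < x" using eq by (simp_all add: x_def)
  have nonzero: "trib_neg j \<noteq> 0" if "j \<in> {n..n + r}" for j
  proof
    assume "trib_neg j = 0"
    then have "trib_neg_prod n (n + r) = 0" unfolding trib_neg_prod_def using that by (intro prod_zero) auto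
    then show False using x by simp
  qed
  have dvd: "q dvd x" if "int q dvd trib_neg j" "j \<in> {n..n + r}" for q j
  proof -
    have "trib_neg j dvd trib_neg_prod n (n + r)"
      unfolding trib_neg_prod_def using that(2) by (intro dvd_prodI) auto
    then have "int q dvd \<bar>trib_neg_prod n (n + r)\<bar>" using that(1) by (meson dvd_trans dvd_abs_iff)
    then show ?thesis unfolding eq x_def by simp
  qed
  have p: "1 \<le> p" "2 * p \<le> r + 1" "r \<le> 2 * p" unfolding p_def using r by auto
  have k: "n \<le> 4 * 2 ^ k" unfolding k_def
  proof (rule LeastI)
    show "n \<le> 4 * 2 ^ n" using less_exp[of n] by linarith
  qed
  have k_least: "k \<le> i" if "n \<le> 4 * 2 ^ i" for i unfolding k_def using that by (rule Least_le)
  have k': "2 ^ (k + 1) < n"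
  proof (cases k)
    case (Suc i)
    then have "\<not> n \<le> 4 * 2 ^ i" using k_least[of i] by auto
    then show ?thesis using Suc by simp
  qed (use n in simp)
  have V_eq: "V = (\<Sum>j=n..n + r. multiplicity 2 (trib_neg j))"
    unfolding V_def x(1)[symmetric] multiplicity_2_abs by (rule multiplicity_2_trib_neg_prod[OF nonzero])
  have V: "V \<le> 3 * p + 2 + 4 * k" if "18 \<le> n"
    using sum_multiplicity_2_trib_neg_le[OF that le_add1 k, of r] unfolding V_eq p_def by simp
  have growth: "2 ^ (7 * p * (n + p)) \<le> 2 ^ (47 * p) * int x ^ 16"
  proof -
    have "2 ^ (7 * p * (n + p)) \<le> 2 ^ (47 * p) * trib_neg_prod n (n + r) ^ 16"
      using n nonzero p(2) by (intro trib_neg_prod_growth) auto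
    also have "trib_neg_prod n (n + r) ^ 16 = \<bar>trib_neg_prod n (n + r)\<bar> ^ 16"
      by (simp add: power_even_abs)
    finally show ?thesis unfolding eq x_def .
  qed
  show ?thesis
  proof (cases "103 dvd x")
    case False
    have multiple: "17 * i \<notin> {n..n + r}" for i using dvd[of 103 "17 * i"] dvd_103_trib_neg False by auto
    have x47: "x \<le> 47 ^ V" using fact_prod_le_47_power[of A] False unfolding x_def V_def by simp
    consider "n < 86" | "86 \<le> n" "n < 425" | "425 \<le> n" by linarith
    then show ?thesis
    proof cases
      case 1
      then have "n + r < 86" using multiple[of 5] by auto
      then have "(n, r) \<in> solution_pairs \<or> excluded (nat \<bar>trib_neg_prod n (n + r)\<bar>)"
        using n r False dvd[of 103] by (intro finite_check) auto
      then show ?thesis using not_excluded_fact_prod[of A] False unfolding x(1) x_def by simp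
    next
      case 2
      then have "n + r < 425" using multiple[of 25] by auto
      then have "val_pow 47 x < x" using prod_heavy[of n r] 2 unfolding x(1) by simp
      then show ?thesis using x47 x(2) by (simp add: val_pow_eq V_def)
    next
      case 3
      have "int x \<le> int (47 ^ V)" using x47 by (simp only: of_nat_le_iff)
      then have bound: "int x \<le> 47 ^ V" by simp
      have False by (rule no_small_base_bound[OF growth _ bound V p(1) k' 3]) (use 3 in auto)
      then show ?thesis ..
    qed
  next
    case True
    have "n \<ge> 18"
    proof (rule ccontr)
      assume "\<not> 18 \<le> n"
      then have "n + r \<le> 16" using nonzero[of 17] n by (force simp: trib_neg_values)
      have "int 103 dvd \<bar>trib_neg_prod n (n + r)\<bar>"
        unfolding eq x_def[symmetric] using True by (simp only: of_nat_dvd_iff)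
      then have "103 dvd (\<Prod>j=n..n + r. trib_neg j)" by (simp add: trib_neg_prod_def)
      moreover have "prime (103::int)" by simp
      ultimately obtain j where j: "j \<in> {n..n + r}" "103 dvd trib_neg j"
        by (auto simp: prime_dvd_prod_iff)
      then have "j \<in> set [5..<17]" using n \<open>n + r \<le> 16\<close> unfolding set_upt by simp
      then show False using j(2) by (auto simp: trib_neg_values)
    qed
    \<comment> \<open>Some factorial is at least $103!$, and $103 < 2^7$ gives the exponent $103 - 7$.\<close>
    have V96: "96 \<le> V"
      using multiplicity_2_ge_of_prime_dvd[of 103 A 7] True unfolding V_def x_def by simp
    have "x \<le> (2 * V + 4) ^ V" using fact_prod_le_power[of A] V96 unfolding V_def x_def by simp
    then have "int x \<le> int ((2 * V + 4) ^ V)" by (simp only: of_nat_le_iff)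
    then have "int x \<le> (2 * int V + 4) ^ V" by simp
    then have quad: "5 * (int p * int p) + 14 * (int p * int n) \<le>
       int p * (592 + 24 * int k) + 328 + 664 * int k + 16 * (int k * int k)"
      using V V96 x(2) \<open>18 \<le> n\<close> by (intro growth_quadratic[OF growth]) auto
    \<comment> \<open>A window without 55 and 57 that ends by 54 is too short for $V \<ge> 96$.\<close>
    have "(58 \<le> n \<and> 96 \<le> 3 * p + 2 + 4 * k) \<or> (18 \<le> n \<and> 490 \<le> 3 * p + 2 + 4 * k)"
    proof (cases "499 dvd x")
      case True
      then have "490 \<le> V"
        using multiplicity_2_ge_of_prime_dvd[of 499 A 9] unfolding V_def x_def by simp
      then show ?thesis using V \<open>18 \<le> n\<close> by linarith
    next
      case False
      have "trib_neg 55 = -8377711" "trib_neg 57 = 14375192"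
        using trib_neg_nth[of 50] trib_neg_nth[of 52] by (simp_all only: trib_neg_list) simp_all
      then have "int 499 dvd trib_neg 55" "int 499 dvd trib_neg 57" by simp_all
      then have "55 \<notin> {n..n + r}" "57 \<notin> {n..n + r}" using dvd False by blast+
      then consider "58 \<le> n" | "n + r \<le> 54" using r by force
      then show ?thesis
      proof cases
        case 1
        then show ?thesis using V V96 by linarith
      next
        case 2
        then have "k \<le> 4" by (intro k_least) simp
        moreover have "p \<le> 18" unfolding p_def using 2 \<open>18 \<le> n\<close> by simp
        ultimately show ?thesis using V V96 \<open>18 \<le> n\<close> by linarith
      qed
    qed
    then show ?thesis using growth_quadratic_fails[OF k' p(1)] quad by linarith
  qed
qed

text \<open>A multiset represents the unordered choice of the factorials; sorting it recovers the
  monotone enumeration.\<close>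

lemma factorial_product_iff:
  fixes z :: int
  shows "(\<exists>(k::nat) (m :: nat \<Rightarrow> nat). 1 \<le> k \<and> (\<forall>i\<in>{1..k}. 0 < m i) \<and> mono_on {1..k} m \<and>
           z = (\<Prod>i=1..k. fact (m i)))
     \<longleftrightarrow> (\<exists>A. A \<noteq> {#} \<and> 0 \<notin># A \<and> z = int (fact_prod A))" (is "?lhs \<longleftrightarrow> ?rhs")
proof
  assume ?lhs
  then obtain k and m :: "nat \<Rightarrow> nat"
    where km: "1 \<le> k" "\<forall>i\<in>{1..k}. 0 < m i" "z = (\<Prod>i=1..k. fact (m i))"
    by blast
  define A where "A = image_mset m (mset_set {1..k})"
  have "fact_prod A = (\<Prod>i=1..k. fact (m i))"
    by (simp add: A_def fact_prod_def prod_unfold_prod_mset multiset.map_comp comp_def)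
  moreover have "A \<noteq> {#}" using km(1) by (simp add: A_def mset_set_empty_iff)
  moreover have "0 \<notin># A" using km(2) by (auto simp: A_def)
  ultimately show ?rhs using km by (intro exI[of _ A]) simp
next
  assume ?rhs
  then obtain A where A: "A \<noteq> {#}" "0 \<notin># A" "z = int (fact_prod A)" by blast
  define xs where "xs = sorted_list_of_multiset A"
  define m where "m i = xs ! (i - 1)" for i
  have xs: "mset xs = A" "sorted xs" by (simp_all add: xs_def)
  have "(\<Prod>i=1..length xs. fact (m i)) = (\<Prod>i<length xs. (fact (xs ! i) :: nat))"
    by (rule prod.reindex_bij_witness[of _ Suc "\<lambda>i. i - 1"]) (auto simp: m_def)
  also have "\<dots> = prod_list (map fact xs)"
    by (simp add: prod.list_conv_set_nth lessThan_atLeast0)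
  also have "\<dots> = fact_prod A"
    by (simp add: fact_prod_def flip: xs(1) prod_mset_prod_list)
  finally have "z = int (\<Prod>i=1..length xs. fact (m i))" unfolding A(3) by simp
  then have "z = (\<Prod>i=1..length xs. fact (m i))" by simp
  moreover have "1 \<le> length xs" using A(1) xs(1) by (cases xs) auto
  moreover have "\<forall>i\<in>{1..length xs}. 0 < m i"
  proof
    fix i assume "i \<in> {1..length xs}"
    then have "m i \<in> set xs" by (auto simp: m_def)
    then have "m i \<in># A" using xs(1) by auto
    then show "0 < m i" using A(2) by (metis gr0I)
  qed
  moreover have "mono_on {1..length xs} m"
    unfolding m_def using xs(2) by (intro mono_onI sorted_nth_mono) auto
  ultimately show ?lhs by blast
qed

lemma trib_neg_prod_list: "trib_neg_prod a b = prod_list (map trib_neg [a..<Suc b])"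
  unfolding trib_neg_prod_def
  by (subst prod.distinct_set_conv_list[symmetric])
    (simp_all only: distinct_upt set_upt atLeastLessThanSuc_atLeastAtMost)

lemmas trib_neg_prod_eval = trib_neg_prod_list trib_neg_values fact_numeral

lemma solution_pairs_solvable:
  assumes "(n, r) \<in> solution_pairs"
  shows "\<exists>A. A \<noteq> {#} \<and> 0 \<notin># A \<and> \<bar>trib_neg_prod n (n + r)\<bar> = int (fact_prod A)"
proof -
  define solvable where "solvable n r \<longleftrightarrow>
    (\<exists>A. A \<noteq> {#} \<and> 0 \<notin># A \<and> \<bar>trib_neg_prod n (n + r)\<bar> = int (fact_prod A))" for n r
  have witness: "solvable n r"
    if "A \<noteq> {#}" "0 \<notin># A" "\<bar>trib_neg_prod n (n + r)\<bar> = int (fact_prod A)" for n r A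
    unfolding solvable_def using that by blast
  have w1: "solvable 5 1"
    by (rule witness[of "{#3#}"]) (simp_all add: trib_neg_prod_eval)
  have w2: "solvable 5 2"
    by (rule witness[of "{#3#}"]) (simp_all add: trib_neg_prod_eval)
  have w3: "solvable 5 3"
    by (rule witness[of "{#4#}"]) (simp_all add: trib_neg_prod_eval)
  have w4: "solvable 5 4"
    by (rule witness[of "{#2, 2, 2, 4#}"]) (simp_all add: trib_neg_prod_eval)
  have w5: "solvable 5 5"
    by (rule witness[of "{#2, 2, 2, 5#}"]) (simp_all add: trib_neg_prod_eval)
  have w6: "solvable 5 8"
    by (rule witness[of "{#2, 2, 5, 7#}"]) (simp_all add: trib_neg_prod_eval)
  have w7: "solvable 5 9"
    by (rule witness[of "{#3, 6, 7#}"]) (simp_all add: trib_neg_prod_eval)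
  have w8: "solvable 6 2"
    by (rule witness[of "{#2, 3#}"]) (simp_all add: trib_neg_prod_eval)
  have w9: "solvable 6 3"
    by (rule witness[of "{#2, 2, 4#}"]) (simp_all add: trib_neg_prod_eval)
  have w10: "solvable 6 4"
    by (rule witness[of "{#2, 2, 5#}"]) (simp_all add: trib_neg_prod_eval)
  have w11: "solvable 6 7"
    by (rule witness[of "{#2, 5, 7#}"]) (simp_all add: trib_neg_prod_eval)
  have w12: "solvable 7 1"
    by (rule witness[of "{#2, 2#}"]) (simp_all add: trib_neg_prod_eval)
  have w13: "solvable 7 2"
    by (rule witness[of "{#2, 2, 2, 2, 2#}"]) (simp_all add: trib_neg_prod_eval)
  have w14: "solvable 8 1"
    by (rule witness[of "{#2, 2, 2, 2, 2#}"]) (simp_all add: trib_neg_prod_eval)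
  have w15: "solvable 7 7"
    by (rule witness[of "{#6, 7#}"]) (simp_all add: trib_neg_prod_eval)
  have w16: "solvable 8 6"
    by (rule witness[of "{#6, 7#}"]) (simp_all add: trib_neg_prod_eval)
  have "\<forall>(n, r)\<in>solution_pairs. solvable n r"
    unfolding solution_pairs_def
    by (simp only: ball_simps prod.case simp_thms w1 w2 w3 w4 w5 w6 w7 w8 w9 w10 w11 w12 w13 w14 w15 w16)
  then show ?thesis using assms unfolding solvable_def by blast
qed

theorem theorem2p2:
  shows "{(n, r). 5 \<le> n \<and> 0 < r \<and>
            (\<exists>(k::nat) (m :: nat \<Rightarrow> nat). 1 \<le> k \<and> (\<forall>i\<in>{1..k}. 0 < m i) \<and> mono_on {1..k} m \<and>
               \<bar>trib_neg_prod n (n + r)\<bar> = (\<Prod>i=1..k. fact (m i)))}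
       = {(5,1), (5,2), (5,3), (5,4), (5,5), (5,8), (5,9), (6,2), (6,3), (6,4), (6,7),
          (7,1), (7,2), (8,1), (7,7), (8,6)}
       \<and> \<bar>trib_neg_prod 5 6\<bar> = fact 3 \<and> \<bar>trib_neg_prod 5 7\<bar> = fact 3
       \<and> \<bar>trib_neg_prod 5 8\<bar> = fact 4
       \<and> \<bar>trib_neg_prod 5 9\<bar> = (fact 2)^3 * fact 4
       \<and> \<bar>trib_neg_prod 5 10\<bar> = (fact 2)^3 * fact 5
       \<and> \<bar>trib_neg_prod 5 13\<bar> = (fact 2)^2 * fact 5 * fact 7
       \<and> \<bar>trib_neg_prod 5 14\<bar> = fact 3 * fact 6 * fact 7
       \<and> \<bar>trib_neg_prod 6 8\<bar> = fact 2 * fact 3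
       \<and> \<bar>trib_neg_prod 6 9\<bar> = (fact 2)^2 * fact 4
       \<and> \<bar>trib_neg_prod 6 10\<bar> = (fact 2)^2 * fact 5
       \<and> \<bar>trib_neg_prod 6 13\<bar> = fact 2 * fact 5 * fact 7
       \<and> \<bar>trib_neg_prod 7 8\<bar> = (fact 2)^2
       \<and> \<bar>trib_neg_prod 7 9\<bar> = (fact 2)^5 \<and> \<bar>trib_neg_prod 8 9\<bar> = (fact 2)^5
       \<and> \<bar>trib_neg_prod 7 14\<bar> = fact 6 * fact 7 \<and> \<bar>trib_neg_prod 8 14\<bar> = fact 6 * fact 7"
    (is "?S = ?pairs \<and> ?values")
proof
  let ?sol = "\<lambda>n r A. A \<noteq> {#} \<and> 0 \<notin># A \<and> \<bar>trib_neg_prod n (n + r)\<bar> = int (fact_prod A)"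
  have S: "?S = {(n, r). 5 \<le> n \<and> 0 < r \<and> (\<exists>A. ?sol n r A)}"
    unfolding factorial_product_iff ..
  also have "\<dots> = solution_pairs"
  proof (intro equalityI subsetI; clarify)
    fix n r :: nat and A
    assume "5 \<le> n" "0 < r" "\<bar>trib_neg_prod n (n + r)\<bar> = int (fact_prod A)"
    then show "(n, r) \<in> solution_pairs" by (rule factorial_equation_solutions)
  next
    fix n r assume nr: "(n, r) \<in> solution_pairs"
    then have "5 \<le> n" "0 < r" unfolding solution_pairs_def by auto
    then show "5 \<le> n \<and> 0 < r \<and> (\<exists>A. ?sol n r A)" using solution_pairs_solvable[OF nr] by blast
  qed
  finally show "?S = ?pairs" unfolding solution_pairs_def .
  show ?values by (simp add: trib_neg_prod_eval)
qed

end
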